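(* There is an algorithm that, given a chordal graph $G$ with $n$ vertices and a vertex $z\in V(G)$, decides in $O(n^2)$ time whether there exists a maximum cardinality search (\textsc{mcs}) ordering of $G$ whose last vertex is $z$ (the \textsc{mcs} end vertex problem).
   Context: A graph is chordal if it contains no induced cycle on four or more vertices. An ordering of $V(G)$ is a bijection $\sigma:V(G)\to\{1,\dots,n\}$; its end vertex is $\sigma^{-1}(n)$. An \textsc{mcs} ordering is an ordering $v_1,\dots,v_n$ produced by the following procedure: $v_1$ is arbitrary, and for each $i\ge 2$, $v_i$ is chosen (ties broken arbitrarily) among the unvisited vertices having the maximum number of neighbors in $\{v_1,\dots,v_{i-1}\}$. The \textsc{mcs} end vertex problem asks, for a given graph $G$ and vertex $z$, whether some \textsc{mcs} ordering of $G$ has end vertex $z$. *)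

theory Defs
  imports Complex_Main "HOL-Library.Landau_Symbols"
begin

definition simple_graph :: "'a set \<Rightarrow> 'a set set \<Rightarrow> bool" where
  "simple_graph V E \<longleftrightarrow> finite V \<and> (\<forall>e\<in>E. e \<subseteq> V \<and> card e = 2)"

text \<open>A list \<open>vs\<close> is an induced cycle if its entries are distinct vertices and the only edges
  among them join cyclically consecutive entries.\<close>

definition induced_cycle :: "'a set \<Rightarrow> 'a set set \<Rightarrow> 'a list \<Rightarrow> bool" where
  "induced_cycle V E vs \<longleftrightarrow>
     3 \<le> length vs \<and> distinct vs \<and> set vs \<subseteq> V \<and>
     (\<forall>i j. i < j \<and> j < length vs \<longrightarrow>
        ({vs ! i, vs ! j} \<in> E \<longleftrightarrow> j = Suc i \<or> (i = 0 \<and> j = length vs - 1)))"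

definition chordal :: "'a set \<Rightarrow> 'a set set \<Rightarrow> bool" where
  "chordal V E \<longleftrightarrow> \<not> (\<exists>vs. induced_cycle V E vs \<and> 4 \<le> length vs)"

definition neighbors :: "'a set set \<Rightarrow> 'a \<Rightarrow> 'a set" where
  "neighbors E v = {u. {u, v} \<in> E}"

definition vertex_ordering :: "'a set \<Rightarrow> ('a \<Rightarrow> nat) \<Rightarrow> bool" where
  "vertex_ordering V \<sigma> \<longleftrightarrow> bij_betw \<sigma> V {1..card V}"

definition end_vertex :: "'a set \<Rightarrow> ('a \<Rightarrow> nat) \<Rightarrow> 'a" where
  "end_vertex V \<sigma> = inv_into V \<sigma> (card V)"

text \<open>The sequences of vertices that the search may have visited at some point of its execution.\<close>

inductive mcs_run :: "'a set \<Rightarrow> 'a set set \<Rightarrow> 'a list \<Rightarrow> bool" for V E where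
  start: "v \<in> V \<Longrightarrow> mcs_run V E [v]"
| visit: "mcs_run V E vs \<Longrightarrow> v \<in> V - set vs \<Longrightarrow>
    (\<forall>u \<in> V - set vs. card (neighbors E u \<inter> set vs) \<le> card (neighbors E v \<inter> set vs)) \<Longrightarrow>
    mcs_run V E (vs @ [v])"

definition mcs_ordering :: "'a set \<Rightarrow> 'a set set \<Rightarrow> ('a \<Rightarrow> nat) \<Rightarrow> bool" where
  "mcs_ordering V E \<sigma> \<longleftrightarrow>
     vertex_ordering V \<sigma> \<and> mcs_run V E (map (inv_into V \<sigma>) [1..<Suc (card V)])"

definition mcs_end_vertex :: "'a set \<Rightarrow> 'a set set \<Rightarrow> 'a \<Rightarrow> bool" where
  "mcs_end_vertex V E z \<longleftrightarrow> (\<exists>\<sigma>. mcs_ordering V E \<sigma> \<and> end_vertex V \<sigma> = z)"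

text \<open>Algorithms are programs of a while language over scalar variables and random access arrays
  of natural numbers. Every operator, memory access, test and control step has unit cost.
  Subtraction is truncated.\<close>

datatype aexp =
    Num nat
  | Var string
  | Get string aexp
  | Plus aexp aexp
  | Minus aexp aexp
  | Times aexp aexp

datatype bexp =
    Less aexp aexp
  | Equal aexp aexp
  | Neg bexp
  | Conj bexp bexp

datatype com =
    Skip
  | Assign string aexp
  | Put string aexp aexp
  | Seq com com
  | If bexp com com
  | While bexp com

type_synonym state = "(string \<Rightarrow> nat) \<times> (string \<Rightarrow> nat \<Rightarrow> nat)"

fun aval :: "aexp \<Rightarrow> state \<Rightarrow> nat" where
  "aval (Num k) s = k"
| "aval (Var x) s = fst s x"
| "aval (Get a e) s = snd s a (aval e s)"
| "aval (Plus e f) s = aval e s + aval f s"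
| "aval (Minus e f) s = aval e s - aval f s"
| "aval (Times e f) s = aval e s * aval f s"

fun bval :: "bexp \<Rightarrow> state \<Rightarrow> bool" where
  "bval (Less e f) s \<longleftrightarrow> aval e s < aval f s"
| "bval (Equal e f) s \<longleftrightarrow> aval e s = aval f s"
| "bval (Neg b) s \<longleftrightarrow> \<not> bval b s"
| "bval (Conj b c) s \<longleftrightarrow> bval b s \<and> bval c s"

fun acost :: "aexp \<Rightarrow> nat" where
  "acost (Num k) = 1"
| "acost (Var x) = 1"
| "acost (Get a e) = 1 + acost e"
| "acost (Plus e f) = 1 + acost e + acost f"
| "acost (Minus e f) = 1 + acost e + acost f"
| "acost (Times e f) = 1 + acost e + acost f"

fun bcost :: "bexp \<Rightarrow> nat" where
  "bcost (Less e f) = 1 + acost e + acost f"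
| "bcost (Equal e f) = 1 + acost e + acost f"
| "bcost (Neg b) = 1 + bcost b"
| "bcost (Conj b c) = 1 + bcost b + bcost c"

text \<open>\<open>exec W c s t s'\<close>: started in state \<open>s\<close>, the program \<open>c\<close> terminates in state \<open>s'\<close> after
  \<open>t\<close> steps. All stored values and all addresses written to have to be smaller than \<open>W\<close>;
  a program violating this gets stuck. For \<open>W\<close> polynomial in the input size this is
  the usual restriction to words of logarithmic length, which makes the unit-cost measure
  realistic: intermediate values inside an expression of a fixed program are then also polynomially
  bounded.\<close>

inductive exec :: "nat \<Rightarrow> com \<Rightarrow> state \<Rightarrow> nat \<Rightarrow> state \<Rightarrow> bool" for W where
  Skip: "exec W Skip s 1 s"
| Assign: "aval e s < W \<Longrightarrow>
    exec W (Assign x e) s (1 + acost e) ((fst s)(x := aval e s), snd s)"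
| Put: "aval i s < W \<Longrightarrow> aval e s < W \<Longrightarrow>
    exec W (Put a i e) s (1 + acost i + acost e)
      (fst s, (snd s)(a := (snd s a)(aval i s := aval e s)))"
| Seq: "exec W c s t s' \<Longrightarrow> exec W d s' u s'' \<Longrightarrow> exec W (Seq c d) s (t + u) s''"
| IfTrue: "bval b s \<Longrightarrow> exec W c s t s' \<Longrightarrow> exec W (If b c d) s (1 + bcost b + t) s'"
| IfFalse: "\<not> bval b s \<Longrightarrow> exec W d s t s' \<Longrightarrow> exec W (If b c d) s (1 + bcost b + t) s'"
| WhileFalse: "\<not> bval b s \<Longrightarrow> exec W (While b c) s (1 + bcost b) s"
| WhileTrue: "bval b s \<Longrightarrow> exec W c s t s' \<Longrightarrow> exec W (While b c) s' u s'' \<Longrightarrow>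
    exec W (While b c) s (1 + bcost b + t + u) s''"

lemma exec_deterministic:
  "exec W c s t s' \<Longrightarrow> exec W c s u s'' \<Longrightarrow> u = t \<and> s'' = s'"
proof (induction arbitrary: u s'' rule: exec.induct)
  case (WhileTrue b s c t s' v r)
  from WhileTrue.prems WhileTrue.hyps(1) show ?case
    by (cases rule: exec.cases) (use WhileTrue.IH in blast)+
qed (erule exec.cases; blast)+

text \<open>A graph on the vertices \<open>0, \<dots>, n - 1\<close> is given by its number of vertices and its
  adjacency matrix, stored row by row; the remaining memory is initially zero.\<close>

definition input_state :: "nat \<Rightarrow> nat set set \<Rightarrow> nat \<Rightarrow> state" where
  "input_state n E z =
     ((\<lambda>_. 0)(''n'' := n, ''z'' := z),
      (\<lambda>_ _. 0)(''adj'' := (\<lambda>p. of_bool ({p div n, p mod n} \<in> E))))"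

definition answer :: "state \<Rightarrow> nat" where
  "answer s = fst s ''answer''"

end

theory Submission
  imports Defs
begin

text \<open>The program runs the search twice: first from \<open>z\<close>, then with ties broken in favour of the
  vertex visited latest in the first sweep, and it answers whether the second sweep \<open>rs\<close> ends in \<open>z\<close>.
  If it does, \<open>rs\<close> itself is a witness. For the converse, let \<open>core m\<close> be the longest prefix
  of the first sweep in which every vertex beyond the first clique has at least \<open>m\<close> earlier
  neighbours. A vertex outside \<open>core m\<close> has fewer than \<open>m\<close> neighbours in it, and the \<open>m\<close>-cliques of
  \<open>core m\<close> are connected through its \<open>(m+1)\<close>-cliques. Hence any search that completes an \<open>m\<close>-clique of
  \<open>core m\<close> exhausts \<open>core m\<close> before leaving it, so a search ending in \<open>z\<close> must have visited all
  vertices outside \<open>core m\<close> by then. By induction on \<open>m\<close> the second sweep has this property as well: were it to enter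
  \<open>core m\<close> too early, the search ending in \<open>z\<close> would provide an equally labelled vertex outside
  \<open>core m\<close>, which the tie-breaking prefers. For \<open>m = card N[z]\<close> the core is \<open>N[z]\<close>,
  and there the tie-breaking leaves \<open>z\<close> for last.

  Chordality enters only through the fact that a clique in the neighbourhood of a
  connected set is in the neighbourhood of one of its vertices.\<close>

subsection \<open>Cliques and connected sets in chordal graphs\<close>

text \<open>A complete search as a list, indexed from \<open>0\<close>. Over the empty prefix all
  labels are \<open>0\<close>, so the condition at \<open>i = 0\<close> leaves the start
  arbitrary.\<close>

definition mcs_seq :: "'a set \<Rightarrow> 'a set set \<Rightarrow> 'a list \<Rightarrow> bool" where
  "mcs_seq V E xs \<longleftrightarrow> distinct xs \<and> set xs = V \<and>
     (\<forall>i<length xs. \<forall>u\<in>V - set (take i xs).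
        card (neighbors E u \<inter> set (take i xs)) \<le> card (neighbors E (xs ! i) \<inter> set (take i xs)))"

definition clique :: "'a set \<Rightarrow> 'a set set \<Rightarrow> 'a set \<Rightarrow> bool" where
  "clique V E Q \<longleftrightarrow> Q \<subseteq> V \<and> (\<forall>x\<in>Q. \<forall>y\<in>Q. x \<noteq> y \<longrightarrow> y \<in> neighbors E x)"

definition reach :: "'a set set \<Rightarrow> 'a set \<Rightarrow> ('a \<times> 'a) set" where
  "reach E C = {(x, y). x \<in> C \<and> y \<in> C \<and> y \<in> neighbors E x}\<^sup>*"

definition conn :: "'a set set \<Rightarrow> 'a set \<Rightarrow> bool" where
  "conn E C \<longleftrightarrow> (\<forall>x\<in>C. \<forall>y\<in>C. (x, y) \<in> reach E C)"

lemma clique_subset: "clique V E Q \<Longrightarrow> R \<subseteq> Q \<Longrightarrow> clique V E R"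
  unfolding clique_def by blast

lemma cliqueD: "clique V E Q \<Longrightarrow> x \<in> Q \<Longrightarrow> y \<in> Q \<Longrightarrow> x \<noteq> y \<Longrightarrow> y \<in> neighbors E x"
  unfolding clique_def by blast

lemma neighbors_sym: "x \<in> neighbors E y \<longleftrightarrow> y \<in> neighbors E x"
  by (simp add: neighbors_def insert_commute)

lemma reach_refl: "(x, x) \<in> reach E C"
  by (simp add: reach_def)

lemma reach_trans: "(x, y) \<in> reach E C \<Longrightarrow> (y, z) \<in> reach E C \<Longrightarrow> (x, z) \<in> reach E C"
  unfolding reach_def by simp

lemma reach_edge: "x \<in> C \<Longrightarrow> y \<in> C \<Longrightarrow> y \<in> neighbors E x \<Longrightarrow> (x, y) \<in> reach E C"
  unfolding reach_def by blast

lemma reach_sym: "(x, y) \<in> reach E C \<Longrightarrow> (y, x) \<in> reach E C"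
  unfolding reach_def
  by (rule symD[OF sym_rtrancl]) (auto simp: sym_def neighbors_sym)

lemma reach_mono: "(x, y) \<in> reach E C \<Longrightarrow> C \<subseteq> D \<Longrightarrow> (x, y) \<in> reach E D"
  unfolding reach_def by (rule rtrancl_mono[THEN subsetD]) auto

lemma conn_insert:
  assumes "conn E C" "c \<in> C" "v \<in> neighbors E c"
  shows "conn E (insert v C)"
proof -
  have from_c: "(c, x) \<in> reach E (insert v C)" if "x \<in> insert v C" for x
  proof (cases "x = v")
    case True
    then show ?thesis using assms by (auto intro: reach_edge)
  next
    case False
    then have "(c, x) \<in> reach E C" using that assms by (auto simp: conn_def)
    then show ?thesis by (rule reach_mono) blast
  qed
  then show ?thesis unfolding conn_def by (blast intro: reach_trans reach_sym)
qed

locale chordal_graph =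
  fixes V :: "'a set" and E :: "'a set set"
  assumes simple: "simple_graph V E" and chordal: "chordal V E"
begin

abbreviation N :: "'a \<Rightarrow> 'a set" where "N \<equiv> neighbors E"

lemma finite_V: "finite V"
  using simple by (simp add: simple_graph_def)

lemma N_subset: "N v \<subseteq> V"
  using simple by (auto simp: simple_graph_def neighbors_def)

lemma N_irrefl: "v \<notin> N v"
  using simple by (auto simp: simple_graph_def neighbors_def)

lemma finite_N: "finite (N v)"
  using finite_subset[OF N_subset finite_V] .

lemma clique_finite: "clique V E Q \<Longrightarrow> finite Q"
  unfolding clique_def using finite_V finite_subset by blast

lemma clique_insert:
  assumes "clique V E Q" "v \<in> V" "Q \<subseteq> N v"
  shows "clique V E (insert v Q)"
  using assms unfolding clique_def by (auto simp: neighbors_sym)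

text \<open>A shortest walk of this kind is an induced path with at least three vertices, and
  \<open>x\<close> closes it to an induced cycle of length at least four. The induction on the
  length of \<open>p\<close> replaces the choice of a shortest walk.\<close>

lemma no_hole:
  assumes "p \<noteq> []" "successively (\<lambda>x y. y \<in> N x) p" "set p \<subseteq> V"
    and "hd p = a" "last p = b" "a \<noteq> b" "b \<notin> N a"
    and "x \<in> V" "x \<notin> set p" "a \<in> N x" "b \<in> N x"
    and "\<forall>y\<in>set p - {a, b}. y \<notin> N x"
  shows False
  using assms
proof (induction p rule: length_induct)
  case (1 p)
  note IH = "1.IH"[rule_format] and p = "1.prems"
  have step: "p ! Suc i \<in> N (p ! i)" if "Suc i < length p" for i
    using p(2) that by (simp add: successively_conv_nth)
  have chordless: "j = Suc i \<or> p ! j \<notin> N (p ! i)" if "i < j" "j < length p" for i j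
  proof (rule ccontr)
    assume neg: "\<not> ?thesis"
    \<comment> \<open>A chord between \<open>p ! i\<close> and \<open>p ! j\<close> lets the walk
      skip everything in between.\<close>
    define q where "q = take (Suc i) p @ drop j p"
    have "last (take (Suc i) p) = p ! i" "hd (drop j p) = p ! j"
      using that by (auto simp: take_Suc_conv_app_nth hd_drop_conv_nth)
    moreover have "successively (\<lambda>x y. y \<in> N x) (take (Suc i) p)"
      "successively (\<lambda>x y. y \<in> N x) (drop j p)"
      using p(2) by (auto simp: successively_conv_nth)
    ultimately have "successively (\<lambda>x y. y \<in> N x) q"
      using neg that unfolding q_def successively_append_iff by auto
    moreover have "Suc i < j" using neg that by simp
    then have "length q < length p" using that by (simp add: q_def)
    moreover have "set q \<subseteq> set p"
      unfolding q_def by (auto dest: in_set_takeD in_set_dropD)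
    moreover have "q \<noteq> []" "hd q = a" "last q = b"
      using that p(1,4,5) by (auto simp: q_def hd_append)
    ultimately show False using IH[of q] p(3) p(6-) by blast
  qed
  have distinct: "distinct p"
  proof (rule ccontr)
    assume "\<not> distinct p"
    then obtain i j where ij: "i < j" "j < length p" "p ! i = p ! j"
      unfolding distinct_conv_nth by (metis linorder_neqE_nat)
    \<comment> \<open>The closed walk between two occurrences of the same vertex is cut out; for
      \<open>i = 0\<close> the first part is empty.\<close>
    define q where "q = take i p @ drop j p"
    have "i > 0 \<Longrightarrow> last (take i p) = p ! (i - 1)" "hd (drop j p) = p ! i"
      using ij by (cases i; auto simp: take_Suc_conv_app_nth hd_drop_conv_nth)+
    moreover have "i > 0 \<Longrightarrow> p ! i \<in> N (p ! (i - 1))"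
      using step[of "i - 1"] ij by simp
    moreover have "successively (\<lambda>x y. y \<in> N x) (take i p)"
      "successively (\<lambda>x y. y \<in> N x) (drop j p)"
      using p(2) by (auto simp: successively_conv_nth)
    ultimately have "successively (\<lambda>x y. y \<in> N x) q"
      using ij unfolding q_def successively_append_iff by auto
    moreover have "length q < length p" using ij by (simp add: q_def)
    moreover have "set q \<subseteq> set p"
      unfolding q_def by (auto dest: in_set_takeD in_set_dropD)
    moreover have "q \<noteq> []" "last q = b"
      using ij p(1,5) by (auto simp: q_def)
    moreover have "hd q = a"
      using ij p(1,4) by (cases "i = 0") (auto simp: q_def hd_append hd_drop_conv_nth hd_conv_nth)
    ultimately show False using IH[of q] p(3) p(6-) by blast
  qed
  have a: "p ! 0 = a" using p(1,4) by (simp add: hd_conv_nth)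
  have b: "p ! (length p - 1) = b" using p(1,5) by (simp add: last_conv_nth)
  have "length p \<noteq> 1" using a b p(6) by auto
  moreover have "length p \<noteq> 2" using a b p(7) step[of 0] by auto
  ultimately have len: "length p \<ge> 3" using p(1) by (cases "length p") auto
  have "induced_cycle V E (x # p)"
    unfolding induced_cycle_def
  proof (intro conjI allI impI)
    show "3 \<le> length (x # p)" using len by simp
    show "distinct (x # p)" using distinct p(9) by simp
    show "set (x # p) \<subseteq> V" using p(3,8) by simp
    fix i j assume ij: "i < j \<and> j < length (x # p)"
    then obtain j' where j': "j = Suc j'" "j' < length p" by (cases j) auto
    show "({(x # p) ! i, (x # p) ! j} \<in> E) = (j = Suc i \<or> i = 0 \<and> j = length (x # p) - 1)"
    proof (cases i)
      case 0
      have "p ! j' = a \<longleftrightarrow> j' = 0" "p ! j' = b \<longleftrightarrow> j' = length p - 1"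
        using distinct a b j'(2) p(1) by (metis length_greater_0_conv nth_eq_iff_index_eq,
            metis diff_less length_greater_0_conv nth_eq_iff_index_eq zero_less_one)
      moreover have "p ! j' \<in> N x \<longleftrightarrow> p ! j' = a \<or> p ! j' = b"
        using p(10-12) j'(2) nth_mem by blast
      ultimately show ?thesis using 0 j' by (auto simp: neighbors_def insert_commute)
    next
      case (Suc i')
      have "p ! j' \<in> N (p ! i') \<longleftrightarrow> j' = Suc i'"
        using chordless[of i' j'] step[of i'] ij j' Suc by auto
      then show ?thesis using Suc j' by (auto simp: neighbors_def insert_commute)
    qed
  qed
  moreover have "4 \<le> length (x # p)" using len by simp
  ultimately show False using chordal unfolding chordal_def by blast
qed

text \<open>Follow a walk from \<open>c\<close> towards \<open>d\<close> inside \<open>C\<close> and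
  stop at the first neighbour of \<open>b\<close>.\<close>

lemma first_neighbor_path:
  assumes "(c, d) \<in> reach E C" "c \<in> C" "d \<in> N b"
  shows "\<exists>p. p \<noteq> [] \<and> successively (\<lambda>x y. y \<in> N x) p \<and> set p \<subseteq> C \<and> hd p = c \<and> last p \<in> N b \<and>
           (\<forall>y\<in>set (butlast p). y \<notin> N b)"
  using assms(1,2) unfolding reach_def
proof (induction rule: converse_rtrancl_induct)
  case base
  then show ?case using assms(3) by (intro exI[of _ "[d]"]) auto
next
  case (step y z)
  then obtain p where p: "p \<noteq> []" "successively (\<lambda>x y. y \<in> N x) p" "set p \<subseteq> C" "hd p = z"
    "last p \<in> N b" "\<forall>y\<in>set (butlast p). y \<notin> N b" by auto
  show ?case
  proof (cases "y \<in> N b")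
    case True
    then show ?thesis using step by (intro exI[of _ "[y]"]) auto
  next
    case False
    then show ?thesis using p step by (intro exI[of _ "y # p"]) (auto simp: successively_Cons)
  qed
qed

text \<open>Take \<open>c\<close> in \<open>C\<close> with the most neighbours in \<open>B\<close>.
  If it misses some \<open>b\<close>, walk from \<open>c\<close> inside \<open>C\<close> to the
  first neighbour of \<open>b\<close>. That vertex still sees every \<open>b'\<close> in
  \<open>B\<close> that \<open>c\<close> sees, since otherwise \<open>no_hole\<close> applies, and
  it sees \<open>b\<close> in addition, against the choice of \<open>c\<close>.\<close>

lemma full_vertex:
  assumes C: "conn E C" "C \<noteq> {}" "C \<subseteq> V" and B: "clique V E B" "B \<inter> C = {}" "B \<subseteq> \<Union> (N ` C)"
  shows "\<exists>c\<in>C. B \<subseteq> N c"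
proof -
  have fB: "finite B" using B(1) by (rule clique_finite)
  have fC: "finite C" using C(3) finite_V finite_subset by blast
  have "Max ((\<lambda>c. card (N c \<inter> B)) ` C) \<in> (\<lambda>c. card (N c \<inter> B)) ` C"
    using fC C(2) by (intro Max_in) auto
  then obtain c where c: "c \<in> C" "Max ((\<lambda>c. card (N c \<inter> B)) ` C) = card (N c \<inter> B)" by auto
  have cmax: "card (N d \<inter> B) \<le> card (N c \<inter> B)" if "d \<in> C" for d
    using Max_ge[of "(\<lambda>c. card (N c \<inter> B)) ` C" "card (N d \<inter> B)"] fC that c(2) by simp
  have "B \<subseteq> N c"
  proof (rule ccontr)
    assume "\<not> B \<subseteq> N c"
    then obtain b where b: "b \<in> B" "b \<notin> N c" by auto
    then obtain d where d: "d \<in> C" "d \<in> N b" using B(3) neighbors_sym by fast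
    obtain p where p: "p \<noteq> []" "successively (\<lambda>x y. y \<in> N x) p" "set p \<subseteq> C" "hd p = c"
      "last p \<in> N b" "\<forall>y\<in>set (butlast p). y \<notin> N b"
      using first_neighbor_path[of c d C b] c(1) d C(1) unfolding conn_def by auto
    have bl: "b \<in> N (last p)" using p(5) neighbors_sym by fast
    have "b' \<in> N (last p)" if b': "b' \<in> N c" "b' \<in> B" for b'
    proof (rule ccontr)
      assume neg: "b' \<notin> N (last p)"
      have "\<exists>y\<in>set p. y \<in> N b'" using b' p(1,4) neighbors_sym by (metis hd_in_set)
      \<comment> \<open>\<open>y\<close> is the last neighbour of \<open>b'\<close> on the walk.
        From \<open>y\<close> on, the walk extended by \<open>b\<close> has only its two ends
        adjacent to \<open>b'\<close>.\<close>
      from split_list_last_prop[OF this]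
      obtain ys y zs where split: "p = ys @ y # zs" "y \<in> N b'" "\<forall>z\<in>set zs. z \<notin> N b'"
        by auto
      have zs: "zs \<noteq> []" using split(1,2) neg neighbors_sym by fastforce
      have bb': "b \<noteq> b'" using b b' by auto
      have "y \<in> set (butlast p)" using split(1) zs by (simp add: butlast_append)
      then have "b \<notin> N y" using p(6) neighbors_sym by fast
      moreover have "successively (\<lambda>x y. y \<in> N x) ((y # zs) @ [b])"
        unfolding successively_append_iff
        using p(2) split(1) zs bl by (auto simp: successively_append_iff)
      moreover have "set (y # zs @ [b]) \<subseteq> V" "b' \<in> V" "b' \<notin> set (y # zs @ [b])" "y \<noteq> b"
        using p(3) C(3) B(1,2) b(1) b' bb' split(1) by (auto simp: clique_def)
      moreover have "b \<in> N b'" using B(1) b b' bb' by (auto simp: clique_def)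
      ultimately show False
        using no_hole[of "y # zs @ [b]" y b b'] split(2,3) by auto
    qed
    then have "insert b (N c \<inter> B) \<subseteq> N (last p) \<inter> B" using p(5) b(1) neighbors_sym by fast
    then have "card (insert b (N c \<inter> B)) \<le> card (N (last p) \<inter> B)"
      using fB by (intro card_mono) auto
    moreover have "last p \<in> C" using p(1,3) by auto
    ultimately show False using cmax[of "last p"] b fB by simp
  qed
  then show ?thesis using c by blast
qed

end

subsection \<open>Maximum cardinality search orders\<close>

abbreviation pre :: "'a list \<Rightarrow> nat \<Rightarrow> 'a set" where
  "pre xs i \<equiv> set (take i xs)"

lemma pre_conv: "i \<le> length xs \<Longrightarrow> x \<in> pre xs i \<longleftrightarrow> (\<exists>j<i. x = xs ! j)"
  by (auto simp: in_set_conv_nth)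

lemma pre_Suc: "i < length xs \<Longrightarrow> pre xs (Suc i) = insert (xs ! i) (pre xs i)"
  by (simp add: take_Suc_conv_app_nth)

lemma pre_mono: "i \<le> j \<Longrightarrow> pre xs i \<subseteq> pre xs j"
  by (rule set_take_subset_set_take)

lemma nth_notin_pre: "distinct xs \<Longrightarrow> i < length xs \<Longrightarrow> xs ! i \<notin> pre xs i"
  by (auto simp: in_set_conv_nth nth_eq_iff_index_eq)

lemma card_pre: "distinct xs \<Longrightarrow> i \<le> length xs \<Longrightarrow> card (pre xs i) = i"
  by (simp add: distinct_card)

context chordal_graph
begin

lemma mcs_label:
  "mcs_seq V E xs \<Longrightarrow> i < length xs \<Longrightarrow> u \<in> V - pre xs i \<Longrightarrow>
     card (N u \<inter> pre xs i) \<le> card (N (xs ! i) \<inter> pre xs i)"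
  by (simp add: mcs_seq_def)

lemma mcs_distinct: "mcs_seq V E xs \<Longrightarrow> distinct xs"
  and mcs_set: "mcs_seq V E xs \<Longrightarrow> set xs = V"
  by (auto simp: mcs_seq_def)

lemma mcs_nth: "mcs_seq V E xs \<Longrightarrow> i < length xs \<Longrightarrow> xs ! i \<in> V - pre xs i"
  using nth_notin_pre mcs_distinct mcs_set nth_mem by fast

lemma pre_subset: "mcs_seq V E xs \<Longrightarrow> pre xs i \<subseteq> V"
  using mcs_set set_take_subset by fast

text \<open>By \<open>full_vertex\<close> some vertex of \<open>C\<close> sees the whole visited
  neighbourhood of \<open>C\<close>. The next vertex has at least that label, and its visited
  neighbours lie in the same set, so it sees all of it too.\<close>

lemma full_next_vertex:
  assumes xs: "mcs_seq V E xs" "i < length xs"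
    and C: "conn E C" "C \<subseteq> V - pre xs i" "xs ! i \<in> C"
    and B: "clique V E (\<Union> (N ` C) \<inter> pre xs i)"
  shows "\<Union> (N ` C) \<inter> pre xs i = N (xs ! i) \<inter> pre xs i"
proof -
  let ?B = "\<Union> (N ` C) \<inter> pre xs i"
  obtain c where c: "c \<in> C" "?B \<subseteq> N c"
    using full_vertex[OF C(1) _ _ B] C(2,3) by blast
  have "card ?B \<le> card (N c \<inter> pre xs i)"
    using c(2) by (intro card_mono) auto
  also have "\<dots> \<le> card (N (xs ! i) \<inter> pre xs i)"
    using mcs_label[OF xs] c(1) C(2) by auto
  finally have "N (xs ! i) \<inter> pre xs i = ?B"
    using C(3) by (intro card_seteq) auto
  then show ?thesis by simp
qed

text \<open>If the newly visited vertex touches \<open>C\<close>, then adding it to \<open>C\<close>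
  gives a connected set that was unvisited one step earlier. The neighbourhood of that set is a
  clique by induction and consists of neighbours of the new vertex, so the new vertex can be added
  to it.\<close>

lemma nbhd_clique:
  assumes xs: "mcs_seq V E xs"
  shows "i \<le> length xs \<Longrightarrow> conn E C \<Longrightarrow> C \<subseteq> V - pre xs i \<Longrightarrow> clique V E (\<Union> (N ` C) \<inter> pre xs i)"
proof (induction i arbitrary: C)
  case 0
  then show ?case by (simp add: clique_def)
next
  case (Suc i)
  let ?v = "xs ! i" and ?W = "pre xs i"
  have i: "i < length xs" and W: "pre xs (Suc i) = insert ?v ?W"
    using Suc.prems(1) by (auto simp: pre_Suc)
  have CW: "C \<subseteq> V - ?W" using Suc.prems(3) W by auto
  show ?case
  proof (cases "?v \<in> \<Union> (N ` C)")
    case False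
    then have "\<Union> (N ` C) \<inter> pre xs (Suc i) = \<Union> (N ` C) \<inter> ?W" using W by auto
    then show ?thesis using Suc.IH[of C] CW Suc.prems i by simp
  next
    case True
    then obtain c where c: "c \<in> C" "?v \<in> N c" by auto
    let ?C = "insert ?v C"
    have conn: "conn E ?C" using conn_insert[OF Suc.prems(2) c] .
    have sub: "?C \<subseteq> V - ?W" using CW mcs_nth[OF xs i] by auto
    have B: "clique V E (\<Union> (N ` ?C) \<inter> ?W)" using Suc.IH[OF _ conn sub] i by simp
    then have eq: "\<Union> (N ` ?C) \<inter> ?W = N ?v \<inter> ?W"
      using full_next_vertex[OF xs i conn sub] by auto
    have "clique V E (insert ?v (N ?v \<inter> ?W))"
      using clique_insert[of "N ?v \<inter> ?W" ?v] B eq sub by auto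
    then show ?thesis by (rule clique_subset) (use W eq in auto)
  qed
qed

lemma nbhd_next:
  "mcs_seq V E xs \<Longrightarrow> i < length xs \<Longrightarrow> conn E C \<Longrightarrow> C \<subseteq> V - pre xs i \<Longrightarrow> xs ! i \<in> C \<Longrightarrow>
     \<Union> (N ` C) \<inter> pre xs i = N (xs ! i) \<inter> pre xs i"
  using full_next_vertex nbhd_clique less_imp_le by metis

text \<open>The case of a single unvisited vertex: the reverse of a search order is a perfect
  elimination ordering.\<close>

lemma earlier_neighbors_clique:
  assumes "mcs_seq V E xs" "i \<le> length xs" "v \<in> V - pre xs i"
  shows "clique V E (N v \<inter> pre xs i)"
  using nbhd_clique[OF assms(1,2), of "{v}"] assms(3) by (simp add: conn_def reach_refl)

end

section \<open>Cores of a fixed search order\<close>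

locale mcs_core = chordal_graph +
  fixes ts :: "'a list"
  assumes ts: "mcs_seq V E ts"
begin

text \<open>In terms of maximal cliques, the search is Prim's algorithm on the clique graph with weights
  \<open>card (K \<inter> L)\<close>, and \<open>core m\<close> is the union of the cliques connected to the start through weights at
  least \<open>m\<close>. The term \<open>min i m\<close> accounts for the first clique, whose labels grow from \<open>0\<close>.\<close>

definition core :: "nat \<Rightarrow> 'a set" where
  "core m = {ts ! j | j. j < length ts \<and> (\<forall>i\<le>j. min i m \<le> card (N (ts ! i) \<inter> pre ts i))}"

lemma core_prefix:
  obtains k where "k \<le> length ts" "core m = pre ts k"
    "\<And>j. j < k \<Longrightarrow> min j m \<le> card (N (ts ! j) \<inter> pre ts j)"
    "k < length ts \<Longrightarrow> card (N (ts ! k) \<inter> pre ts k) < min k m"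
proof -
  define P where "P k \<longleftrightarrow> k = length ts \<or> card (N (ts ! k) \<inter> pre ts k) < min k m" for k
  define k where "k = (LEAST k. P k)"
  have Pk: "P k" unfolding k_def by (rule LeastI[of _ "length ts"]) (simp add: P_def)
  have kle: "k \<le> length ts" unfolding k_def by (rule Least_le) (simp add: P_def)
  have less: "\<not> P j" if "j < k" for j using that unfolding k_def by (rule not_less_Least)
  then have less': "min j m \<le> card (N (ts ! j) \<inter> pre ts j)" if "j < k" for j
    using that by (force simp: P_def)
  have "core m = {ts ! j | j. j < k}"
  proof -
    have "(j < length ts \<and> (\<forall>i\<le>j. min i m \<le> card (N (ts ! i) \<inter> pre ts i))) \<longleftrightarrow> j < k" for j
    proof
      assume "j < k"
      then show "j < length ts \<and> (\<forall>i\<le>j. min i m \<le> card (N (ts ! i) \<inter> pre ts i))"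
        using less' kle by auto
    next
      assume *: "j < length ts \<and> (\<forall>i\<le>j. min i m \<le> card (N (ts ! i) \<inter> pre ts i))"
      show "j < k"
      proof (rule ccontr)
        assume "\<not> j < k"
        then have "k \<le> j" by simp
        then have "k < length ts" "min k m \<le> card (N (ts ! k) \<inter> pre ts k)" using * by auto
        then show False using Pk unfolding P_def by linarith
      qed
    qed
    then show ?thesis unfolding core_def by simp
  qed
  then have "core m = pre ts k" using kle by (auto simp: pre_conv)
  then show thesis using that[of k] kle less' Pk unfolding P_def by auto
qed

lemma core_subset: "core m \<subseteq> V"
  using core_prefix[of m] pre_subset[OF ts] by metis

lemma finite_core: "finite (core m)"
  using core_subset finite_V finite_subset by blast

lemma core_antimono: "m \<le> m' \<Longrightarrow> core m' \<subseteq> core m"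
proof -
  assume "m \<le> m'"
  then have "min i m \<le> min i m'" for i by simp
  then show ?thesis unfolding core_def by (blast intro: order_trans)
qed

text \<open>The vertex at which the core is cut off has label below \<open>m\<close>, and it was
  chosen with maximum label among all vertices outside the core.\<close>

lemma core_neighbors:
  assumes "v \<in> V" "v \<notin> core m"
  shows "card (N v \<inter> core m) < m"
proof -
  obtain k where k: "k \<le> length ts" "core m = pre ts k"
    "k < length ts \<Longrightarrow> card (N (ts ! k) \<inter> pre ts k) < min k m"
    using core_prefix by metis
  have "k < length ts" using assms k(1,2) mcs_set[OF ts] by (cases "k = length ts") auto
  then show ?thesis using mcs_label[OF ts, of k v] k assms by auto
qed

lemma clique_in_core_le:
  assumes Q: "clique V E Q" "Q \<subseteq> core m" and v: "v \<in> V" "v \<notin> core m" "Q \<subseteq> N v"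
  shows "card Q < m"
proof -
  have "card Q \<le> card (N v \<inter> core m)"
    using Q v finite_core by (intro card_mono) auto
  then show ?thesis using core_neighbors[OF v(1,2)] by simp
qed

text \<open>A label of at least \<open>j\<close> at position \<open>j\<close> means adjacency to all
  \<open>j\<close> earlier vertices.\<close>

lemma pre_clique:
  assumes "r \<le> length ts" "\<And>j. j < r \<Longrightarrow> j \<le> card (N (ts ! j) \<inter> pre ts j)"
  shows "clique V E (pre ts r)"
  using assms
proof (induction r)
  case 0
  then show ?case by (simp add: clique_def)
next
  case (Suc r)
  have "card (N (ts ! r) \<inter> pre ts r) \<ge> card (pre ts r)"
    using Suc.prems card_pre[OF mcs_distinct[OF ts], of r] by simp
  then have "N (ts ! r) \<inter> pre ts r = pre ts r" by (intro card_seteq) auto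
  then have "clique V E (insert (ts ! r) (pre ts r))"
    using Suc mcs_nth[OF ts, of r] by (intro clique_insert) auto
  then show ?case using Suc.prems(1) by (simp add: pre_Suc)
qed

text \<open>If \<open>Q\<close> lies among the first \<open>r\<close> vertices, these form a clique,
  because \<open>r \<le> Suc m\<close> makes their labels as large as possible. Otherwise the last
  vertex of \<open>Q\<close> in the order \<open>ts\<close>, together with its earlier neighbours,
  is a large enough clique containing \<open>Q\<close>. A subset of the right size is cut out at the
  end.\<close>

lemma extend_clique:
  assumes Q: "clique V E Q" "Q \<subseteq> core m" "card Q \<le> r" and r: "r \<le> Suc m" "r \<le> card (core m)"
  obtains J where "clique V E J" "Q \<subseteq> J" "J \<subseteq> core m" "card J = r"
proof -
  obtain k where k: "k \<le> length ts" "core m = pre ts k"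
    "\<And>j. j < k \<Longrightarrow> min j m \<le> card (N (ts ! j) \<inter> pre ts j)"
    using core_prefix by metis
  have rk: "r \<le> k" using r(2) k(1,2) card_pre[OF mcs_distinct[OF ts], of k] by simp
  have "\<exists>J. clique V E J \<and> Q \<subseteq> J \<and> J \<subseteq> core m \<and> r \<le> card J"
  proof (cases "Q \<subseteq> pre ts r")
    case True
    have "clique V E (pre ts r)"
    proof (rule pre_clique)
      show "r \<le> length ts" using rk k by simp
      fix j assume "j < r"
      then show "j \<le> card (N (ts ! j) \<inter> pre ts j)" using k(3)[of j] rk r(1) by simp
    qed
    moreover have "pre ts r \<subseteq> core m" "card (pre ts r) = r"
      using rk k(1,2) pre_mono[of r k ts] card_pre[OF mcs_distinct[OF ts], of r] by auto
    ultimately show ?thesis using True by auto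
  next
    case False
    define I where "I = {j. j < k \<and> ts ! j \<in> Q}"
    have fI: "finite I" by (simp add: I_def)
    obtain x where x: "x \<in> Q" "x \<notin> pre ts r" using False by auto
    then obtain j0 where j0: "j0 < k" "x = ts ! j0"
      using Q(2) k(1,2) pre_conv[of k ts x] by auto
    then have "j0 \<in> I" using x by (simp add: I_def)
    define j where "j = Max I"
    have j: "j \<in> I" unfolding j_def using fI \<open>j0 \<in> I\<close> by (intro Max_in) auto
    have "\<not> j0 < r" using x(2) j0(2) rk k(1) pre_conv[of r ts x] by auto
    then have "r \<le> j0" by simp
    also have "j0 \<le> j" unfolding j_def using fI \<open>j0 \<in> I\<close> by simp
    finally have rj: "r \<le> j" .
    let ?M = "N (ts ! j) \<inter> pre ts j"
    have jl: "j < length ts" "j < k" "ts ! j \<in> Q" using j k(1) by (auto simp: I_def)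
    have M: "clique V E ?M"
      using earlier_neighbors_clique[OF ts, of j] mcs_nth[OF ts, of j] jl by simp
    \<comment> \<open>The label at \<open>j\<close> is at least \<open>min j m\<close>, and both
      \<open>j\<close> and \<open>m\<close> are at least \<open>r - 1\<close>.\<close>
    have cM: "r \<le> Suc (card ?M)" using k(3)[of j] jl rj r(1) by auto
    have "clique V E (insert (ts ! j) ?M)"
      using M mcs_nth[OF ts jl(1)] by (intro clique_insert) auto
    moreover have "Q \<subseteq> insert (ts ! j) ?M"
    proof
      fix y assume y: "y \<in> Q"
      then obtain i where i: "i < k" "y = ts ! i"
        using Q(2) k(1,2) pre_conv[of k ts y] by auto
      then have "i \<le> j" unfolding j_def using fI y by (intro Max_ge) (auto simp: I_def)
      show "y \<in> insert (ts ! j) ?M"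
      proof (cases "i = j")
        case False
        then have "i < j" using \<open>i \<le> j\<close> by simp
        then have "y \<in> pre ts j" using i(2) jl(1) pre_conv[of j ts y] by auto
        moreover from this have "y \<noteq> ts ! j" using mcs_nth[OF ts jl(1)] by auto
        moreover from this have "y \<in> N (ts ! j)"
          using Q(1) y jl(3) unfolding clique_def by metis
        ultimately show ?thesis by simp
      qed (use i in simp)
    qed
    moreover have "insert (ts ! j) ?M \<subseteq> core m"
      using pre_mono[of "Suc j" k ts] jl k(2) pre_Suc[of j ts] by auto
    moreover have "r \<le> card (insert (ts ! j) ?M)"
      using cM mcs_nth[OF ts jl(1)] by simp
    ultimately show ?thesis by blast
  qed
  then obtain J where J: "clique V E J" "Q \<subseteq> J" "J \<subseteq> core m" "r \<le> card J" by auto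
  obtain J' where "Q \<subseteq> J'" "J' \<subseteq> J" "card J' = r"
    using exists_subset_between[OF Q(3) J(4,2) clique_finite[OF J(1)]] by blast
  then show thesis using that[of J'] J clique_subset by blast
qed

text \<open>The \<open>m\<close>-cliques of \<open>core m\<close> are connected through its
  \<open>(m+1)\<close>-cliques: exchanging the last vertex of a clique for an earlier one, step by
  step, leads to the first \<open>m\<close> vertices of \<open>ts\<close>.\<close>

lemma percolation:
  assumes step: "\<And>J Q Q'. clique V E J \<Longrightarrow> J \<subseteq> core m \<Longrightarrow> card J = Suc m \<Longrightarrow> Q \<subseteq> J \<Longrightarrow> Q' \<subseteq> J \<Longrightarrow>
      card Q = m \<Longrightarrow> card Q' = m \<Longrightarrow> \<Phi> Q \<Longrightarrow> \<Phi> Q'"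
    and Q0: "clique V E Q0" "Q0 \<subseteq> core m" "card Q0 = m" "\<Phi> Q0"
    and Q1: "clique V E Q1" "Q1 \<subseteq> core m" "card Q1 = m"
  shows "\<Phi> Q1"
proof -
  obtain k where k: "k \<le> length ts" "core m = pre ts k"
    "\<And>j. j < k \<Longrightarrow> min j m \<le> card (N (ts ! j) \<inter> pre ts j)"
    using core_prefix by metis
  have base: "\<Phi> Q \<longleftrightarrow> \<Phi> (pre ts m)"
    if "k' \<le> k" "clique V E Q" "Q \<subseteq> pre ts k'" "card Q = m" for Q k'
    using that
  proof (induction k' arbitrary: Q)
    case 0
    then show ?case by auto
  next
    case (Suc j)
    let ?x = "ts ! j"
    have j: "j < k" "j < length ts" "pre ts (Suc j) = insert ?x (pre ts j)"
      using Suc.prems k(1) by (auto simp: pre_Suc)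
    show ?case
    proof (cases "?x \<in> Q")
      case False
      then show ?thesis using Suc j by auto
    next
      case x: True
      have Qx: "Q - {?x} \<subseteq> N ?x \<inter> pre ts j"
        using Suc.prems(2,3) x j(3) unfolding clique_def by auto
      have fQ: "finite Q" using Suc.prems(2) by (rule clique_finite)
      have cQ: "m = Suc (card (Q - {?x}))"
        using Suc.prems(4) x fQ by (metis card_Suc_Diff1)
      show ?thesis
      proof (cases "j < m")
        case True
        have "card (pre ts (Suc j)) = Suc j"
          using j(2) card_pre[OF mcs_distinct[OF ts], of "Suc j"] by simp
        \<comment> \<open>Here \<open>Q\<close> has at least as many elements as the prefix
          containing it, so it is the initial clique itself.\<close>
        then have "Q = pre ts (Suc j)"
          using Suc.prems(3,4) True by (intro card_seteq) auto
        then have "Q = pre ts m"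
          using Suc.prems(4) \<open>card (pre ts (Suc j)) = Suc j\<close> by simp
        then show ?thesis by simp
      next
        case False
        let ?M = "N ?x \<inter> pre ts j"
        have "m \<le> card ?M" using k(3)[OF j(1)] False by simp
        \<comment> \<open>Only \<open>m - 1\<close> of the at least \<open>m\<close> earlier
          neighbours of \<open>?x\<close> belong to \<open>Q\<close>, so one of them,
          \<open>y\<close>, can replace \<open>?x\<close>. The old and the new clique both lie in
          \<open>insert y Q\<close>.\<close>
        then have "\<not> ?M \<subseteq> Q - {?x}"
          using cQ card_mono[of "Q - {?x}" ?M] fQ by auto
        then obtain y where y: "y \<in> ?M" "y \<notin> Q" using N_irrefl by auto
        have M: "clique V E ?M"
          using earlier_neighbors_clique[OF ts, of j] mcs_nth[OF ts, of j] j by simp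
        let ?J = "insert y Q" and ?Q' = "insert y (Q - {?x})"
        have "clique V E (insert ?x ?M)"
          using M mcs_nth[OF ts j(2)] by (intro clique_insert) auto
        then have J: "clique V E ?J" by (rule clique_subset) (use Qx y in auto)
        moreover have "?J \<subseteq> core m"
          using Suc.prems(1,3) y k(2) j(3) pre_mono[of "Suc j" k ts] by auto
        moreover have "card ?J = Suc m" "card ?Q' = m"
          using fQ y Suc.prems(4) cQ by auto
        ultimately have "\<Phi> Q \<longleftrightarrow> \<Phi> ?Q'"
          using step[of ?J Q ?Q'] step[of ?J ?Q' Q] Suc.prems(4) by blast
        moreover have "\<Phi> ?Q' \<longleftrightarrow> \<Phi> (pre ts m)"
        proof (rule Suc.IH)
          show "clique V E ?Q'" using J by (rule clique_subset) auto
          show "?Q' \<subseteq> pre ts j" using y Qx by auto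
        qed (use j \<open>card ?Q' = m\<close> in auto)
        ultimately show ?thesis by simp
      qed
    qed
  qed
  show ?thesis using base[of k Q0] base[of k Q1] Q0 Q1 k(2) by simp
qed

text \<open>Otherwise being contained in \<open>W\<close> would percolate: an unvisited vertex in an
  \<open>(m+1)\<close>-clique with \<open>m\<close> vertices in \<open>W\<close> already sees these
  \<open>m\<close> vertices. As every core vertex lies in an \<open>m\<close>-clique of the core,
  \<open>W\<close> would then contain the whole core.\<close>

lemma core_finishes:
  assumes Q: "clique V E Q" "Q \<subseteq> core m" "card Q = m" "Q \<subseteq> W" and m: "m \<ge> 1"
    and W: "\<not> core m \<subseteq> W" "finite W"
  shows "\<exists>v\<in>core m - W. m \<le> card (N v \<inter> W)"
proof (rule ccontr)
  assume neg: "\<not> ?thesis"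
  have step: "B \<subseteq> W"
    if J: "clique V E J" "J \<subseteq> core m" "A \<subseteq> J" "B \<subseteq> J" "card A = m" "A \<subseteq> W" for J A B
  proof (rule subsetI, rule ccontr)
    fix x assume x: "x \<in> B" "x \<notin> W"
    have "A \<subseteq> N x \<inter> W"
    proof
      fix y assume "y \<in> A"
      then have "y \<in> J" "x \<in> J" "x \<noteq> y" "y \<in> W" using J x by auto
      then show "y \<in> N x \<inter> W" using J(1) unfolding clique_def by auto
    qed
    then have "m \<le> card (N x \<inter> W)" using card_mono[of "N x \<inter> W" A] J(5) W(2) by simp
    moreover have "x \<in> core m - W" using J x by auto
    ultimately show False using neg by auto
  qed
  obtain x where x: "x \<in> core m" "x \<notin> W" using W by auto
  have "clique V E {x}" using x core_subset by (auto simp: clique_def)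
  moreover have "m \<le> card (core m)" using Q(2,3) finite_core card_mono by metis
  ultimately obtain J where J: "clique V E J" "{x} \<subseteq> J" "J \<subseteq> core m" "card J = m"
    using extend_clique[of "{x}" m m] x m by auto
  have "J \<subseteq> W"
  proof (rule percolation[of m "\<lambda>Q. Q \<subseteq> W" Q J])
    show "B \<subseteq> W" if "clique V E J" "J \<subseteq> core m" "A \<subseteq> J" "B \<subseteq> J" "card A = m" "A \<subseteq> W" for J A B
      using step[OF that] .
  qed (fact Q J)+
  then show False using x J by blast
qed

text \<open>Visiting \<open>xs ! i\<close> completes the first \<open>m\<close>-clique of
  \<open>core m\<close>, and \<open>Q\<close> is the clique completed. The vertices visited before
  are \<open>pre xs i\<close>.\<close>

definition enters :: "'a list \<Rightarrow> nat \<Rightarrow> nat \<Rightarrow> 'a set \<Rightarrow> bool" where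
  "enters xs m i Q \<longleftrightarrow> i < length xs \<and> clique V E Q \<and> Q \<subseteq> core m \<and> card Q = m \<and> Q \<subseteq> pre xs (Suc i) \<and>
     (\<forall>Q'. clique V E Q' \<longrightarrow> Q' \<subseteq> core m \<longrightarrow> card Q' = m \<longrightarrow> \<not> Q' \<subseteq> pre xs i)"

lemma enters_exists:
  assumes "clique V E Q" "Q \<subseteq> core m" "card Q = m" "Q \<subseteq> pre xs k" "k \<le> length xs" "m \<ge> 1"
  obtains i Q' where "i < k" "enters xs m i Q'"
proof -
  define P where "P j \<longleftrightarrow> (\<exists>Q. clique V E Q \<and> Q \<subseteq> core m \<and> card Q = m \<and> Q \<subseteq> pre xs j)" for j
  have "P k" unfolding P_def using assms by blast
  then have PL: "P (LEAST j. P j)" and le: "(LEAST j. P j) \<le> k" by (auto intro: LeastI Least_le)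
  \<comment> \<open>Since \<open>m \<ge> 1\<close>, the empty prefix contains no
    \<open>m\<close>-clique, so the least prefix that contains one has a last position
    \<open>i\<close>.\<close>
  have nP0: "\<not> P 0" using assms(6) by (auto simp: P_def)
  then obtain i where i: "(LEAST j. P j) = Suc i" using PL by (cases "LEAST j. P j") auto
  then have "\<not> P i" using not_less_Least[of i P] by simp
  then show thesis using that[of i] PL le i assms(5) unfolding enters_def P_def by auto
qed

lemma enters_exists_seq:
  assumes "mcs_seq V E xs" "clique V E Q" "Q \<subseteq> core m" "card Q = m" "m \<ge> 1"
  obtains i Q' where "enters xs m i Q'"
proof -
  have "Q \<subseteq> pre xs (length xs)" using assms(1,2) mcs_set by (auto simp: clique_def)
  then show thesis using enters_exists[OF assms(2-4) _ order_refl assms(5)] that by blast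
qed

subsection \<open>Entering a core\<close>

lemma core_vertex_clique:
  assumes "x \<in> core m" "1 \<le> r" "r \<le> Suc m" "r \<le> card (core m)"
  obtains J where "clique V E J" "x \<in> J" "J \<subseteq> core m" "card J = r"
proof -
  have "clique V E {x}" using assms(1) core_subset by (auto simp: clique_def)
  then show thesis
    using extend_clique[of "{x}" m r] assms that by auto
qed

text \<open>No \<open>m\<close>-clique of the core is fully visited yet, so two
  \<open>m\<close>-subsets of one \<open>(m+1)\<close>-clique both have unvisited vertices, which
  are equal or adjacent. Reachability from \<open>?v\<close> within the unvisited part therefore
  percolates.\<close>

lemma core_remainder_conn:
  assumes xs: "mcs_seq V E xs" and m: "m \<ge> 1" and en: "enters xs m i Q"
  shows "xs ! i \<in> Q" "conn E (core m - pre xs i)"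
proof -
  let ?v = "xs ! i" and ?W = "pre xs i" and ?C = "core m - pre xs i"
  have i: "i < length xs" and Q: "clique V E Q" "Q \<subseteq> core m" "card Q = m" "Q \<subseteq> insert ?v ?W"
    using en pre_Suc[of i xs] by (auto simp: enters_def)
  have no: "\<not> A \<subseteq> ?W" if "clique V E A" "A \<subseteq> core m" "card A = m" for A
    using en that by (auto simp: enters_def)
  show v: "?v \<in> Q" using Q(4) no[OF Q(1-3)] by auto
  have reach: "(?v, x) \<in> reach E ?C" if x: "x \<in> ?C" for x
  proof -
    obtain J where J: "clique V E J" "x \<in> J" "J \<subseteq> core m" "card J = m"
      using core_vertex_clique[of x m m] x m Q(2,3) card_mono[OF finite_core, of Q m] by auto
    have "\<forall>y\<in>J - ?W. (?v, y) \<in> reach E ?C"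
    proof (rule percolation[of m "\<lambda>J. \<forall>y\<in>J - ?W. (?v, y) \<in> reach E ?C" Q J])
      show "\<forall>y\<in>Q - ?W. (?v, y) \<in> reach E ?C" using Q(4) by (auto intro: reach_refl)
      fix J A B
      assume J: "clique V E J" "J \<subseteq> core m" "A \<subseteq> J" "B \<subseteq> J" "card A = m"
        and A: "\<forall>y\<in>A - ?W. (?v, y) \<in> reach E ?C"
      have "clique V E A" using J clique_subset by blast
      then obtain a where a: "a \<in> A" "a \<notin> ?W" using no[of A] J by auto
      show "\<forall>y\<in>B - ?W. (?v, y) \<in> reach E ?C"
      proof
        fix y assume y: "y \<in> B - ?W"
        have "(a, y) \<in> reach E ?C"
        proof (cases "a = y")
          case False
          have "a \<in> J" "y \<in> J" using a y J by auto
          then have "y \<in> N a" "a \<in> ?C" "y \<in> ?C"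
            using False J(1,2) a y unfolding clique_def by auto
          then show ?thesis by (intro reach_edge)
        qed (simp add: reach_refl)
        then show "(?v, y) \<in> reach E ?C" using A a reach_trans[of ?v a E ?C y] by simp
      qed
    qed (fact Q J)+
    then show ?thesis using J x by simp
  qed
  then show "conn E ?C" unfolding conn_def by (blast intro: reach_trans reach_sym)
qed

text \<open>When the search completes its first \<open>m\<close>-clique inside \<open>core m\<close>, the unvisited rest of the core
  is separated from the visited vertices by the \<open>m - 1\<close> other vertices of that clique.\<close>

lemma enters_separator:
  assumes xs: "mcs_seq V E xs" and m: "m \<ge> 1" and en: "enters xs m i Q"
  shows "N (xs ! i) \<inter> pre xs i \<subseteq> core m"
    and "Suc (card (N (xs ! i) \<inter> pre xs i)) = m"
    and "Q = insert (xs ! i) (N (xs ! i) \<inter> pre xs i)"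
    and "\<Union> (N ` (core m - pre xs i)) \<inter> pre xs i = N (xs ! i) \<inter> pre xs i"
proof -
  let ?v = "xs ! i" and ?W = "pre xs i"
  let ?S = "N ?v \<inter> ?W"
  have i: "i < length xs" and Q: "clique V E Q" "Q \<subseteq> core m" "card Q = m" "Q \<subseteq> insert ?v ?W"
    using en pre_Suc[of i xs] by (auto simp: enters_def)
  have no: "\<not> A \<subseteq> ?W" if "clique V E A" "A \<subseteq> core m" "card A = m" for A
    using en that by (auto simp: enters_def)
  have v: "?v \<in> Q" and conn: "conn E (core m - ?W)" using core_remainder_conn[OF xs m en] by auto
  have vW: "?v \<in> V - ?W" using mcs_nth[OF xs i] .
  show "\<Union> (N ` (core m - ?W)) \<inter> ?W = ?S"
    using nbhd_next[OF xs i conn] core_subset v Q(2) vW by auto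
  have S: "clique V E ?S" using earlier_neighbors_clique[OF xs _ vW] i by simp
  have QS: "Q \<subseteq> insert ?v ?S" using Q(1,4) v unfolding clique_def by auto
  show core: "?S \<subseteq> core m"
  \<comment> \<open>A vertex \<open>b\<close> of the separator outside the core would see all of the
    \<open>m\<close>-clique \<open>Q\<close>, more than \<open>core_neighbors\<close>
    permits.\<close>
  proof (rule subsetI, rule ccontr)
    fix b assume b: "b \<in> ?S" "b \<notin> core m"
    have "Q \<subseteq> N b"
    proof
      fix q assume q: "q \<in> Q"
      then have "q \<noteq> b" using b(2) Q(2) by auto
      then show "q \<in> N b" using q QS S b(1) neighbors_sym[of ?v E b] unfolding clique_def by auto
    qed
    moreover have "b \<in> V" using b(1) N_subset by auto
    ultimately show False using clique_in_core_le[OF Q(1,2) _ b(2)] Q(3) by simp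
  qed
  have vS: "?v \<notin> ?S" using vW by auto
  have "m \<le> card (insert ?v ?S)" using card_mono[OF _ QS] Q(3) by simp
  then have le: "m \<le> Suc (card ?S)" using vS by simp
  \<comment> \<open>Otherwise an \<open>m\<close>-clique of the core would have been visited before
    step \<open>i\<close>.\<close>
  have "\<not> m \<le> card ?S"
  proof
    assume "m \<le> card ?S"
    then obtain A where "A \<subseteq> ?S" "card A = m" by (meson obtain_subset_with_card_n)
    then show False using no[of A] clique_subset[OF S] core by blast
  qed
  then show card: "Suc (card ?S) = m" using le by simp
  show "Q = insert ?v ?S"
    using card_seteq[OF _ QS] Q(3) card vS by simp
qed

text \<open>From step \<open>i\<close> on the search visits only core vertices until the core is
  exhausted. As the last vertex belongs to the core, exhaustion happens only at the very end, and
  nothing outside the core can be left at step \<open>i\<close>.\<close>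

lemma end_in_core_late:
  assumes xs: "mcs_seq V E xs" and m: "m \<ge> 1" and z: "last xs \<in> core m" and en: "enters xs m i Q"
  shows "V - core m \<subseteq> pre xs i"
proof (rule subsetI, rule ccontr)
  fix u assume u: "u \<in> V - core m" "u \<notin> pre xs i"
  let ?v = "xs ! i" and ?W = "pre xs i"
  let ?S = "N ?v \<inter> ?W"
  note sep = enters_separator[OF xs m en]
  have i: "i < length xs" and Q: "clique V E Q" "Q \<subseteq> core m" "card Q = m" "Q \<subseteq> pre xs (Suc i)"
    using en by (auto simp: enters_def)
  have claim: "j \<le> length xs \<Longrightarrow> \<not> core m \<subseteq> pre xs j \<Longrightarrow> pre xs j \<subseteq> ?W \<union> core m" if "Suc i \<le> j" for j
    using that
  proof (induction j rule: dec_induct)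
    case base
    then show ?case using sep(3) Q(2) pre_Suc[OF i] by auto
  next
    case (step j)
    have j: "j < length xs" and notj: "\<not> core m \<subseteq> pre xs j"
      using step.prems pre_mono[of j "Suc j" xs] by auto
    then have IH: "pre xs j \<subseteq> ?W \<union> core m" using step.IH by simp
    let ?y = "xs ! j"
    have y: "?y \<in> V - pre xs j" using mcs_nth[OF xs j] .
    have "?y \<in> core m"
    proof (rule ccontr)
      assume yc: "?y \<notin> core m"
      let ?D = "N ?y \<inter> pre xs j"
      have "Q \<subseteq> pre xs j" using Q(4) pre_mono[OF step.hyps(1), of xs] by auto
      then obtain w where w: "w \<in> core m - pre xs j" "m \<le> card (N w \<inter> pre xs j)"
        using core_finishes[OF Q(1-3) _ m notj] by auto
      then have cD: "m \<le> card ?D" using mcs_label[OF xs j, of w] core_subset by force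
      have D: "clique V E ?D" using earlier_neighbors_clique[OF xs _ y] j by simp
      \<comment> \<open>At step \<open>i\<close> the label of \<open>?y\<close> was at most
        \<open>m - 1\<close>, and now it is at least \<open>m\<close>. So \<open>?y\<close> has a
        neighbour \<open>p\<close> visited since then, which lies in the core by induction.\<close>
      have "card (N ?y \<inter> ?W) \<le> card ?S"
        using mcs_label[OF xs i, of ?y] y pre_mono[of i j xs] step.hyps by auto
      then have "card (N ?y \<inter> ?W) < card ?D" using sep(2) cD by simp
      then have "\<not> ?D \<subseteq> N ?y \<inter> ?W" using card_mono[of "N ?y \<inter> ?W" ?D] by auto
      then obtain p where p: "p \<in> ?D" "p \<notin> ?W" by auto
      then have pc: "p \<in> core m - ?W" using IH by auto
      \<comment> \<open>Members of \<open>?D\<close> visited before step \<open>i\<close> are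
        adjacent to \<open>p\<close>, hence belong to the separator. With them \<open>?D\<close>
        becomes a set of at least \<open>m\<close> core neighbours of \<open>?y\<close>.\<close>
      have "?D \<subseteq> core m"
      proof
        fix d assume d: "d \<in> ?D"
        show "d \<in> core m"
        proof (cases "d \<in> ?W")
          case True
          then have "d \<in> N p" using cliqueD[OF D p(1) d] p(2) by auto
          then have "d \<in> ?S" using sep(4) pc True by auto
          then show ?thesis using sep(1) by auto
        qed (use d IH in auto)
      qed
      then show False using clique_in_core_le[OF D _ _ yc] y cD by auto
    qed
    then show ?case using IH pre_Suc[OF j] by auto
  qed
  let ?l = "length xs - 1"
  have "xs \<noteq> []" using i by auto
  then have l: "?l < length xs" and last: "last xs = xs ! ?l" by (simp_all add: last_conv_nth)
  have "pre xs (Suc ?l) = V" using mcs_set[OF xs] i by simp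
  then have V: "V = insert (last xs) (pre xs ?l)" using pre_Suc[OF l] last by simp
  have "u \<noteq> last xs" using u z by auto
  then have u': "u \<in> pre xs ?l" using u V by auto
  have "\<not> core m \<subseteq> pre xs ?l" using z last nth_notin_pre[OF mcs_distinct[OF xs] l] by auto
  moreover have "i \<noteq> ?l" using u u' by auto
  ultimately have "pre xs ?l \<subseteq> ?W \<union> core m" using claim[of ?l] i by auto
  then show False using u u' by auto
qed

text \<open>Since \<open>xs ! i\<close> has maximum label, the inequality says that \<open>u\<close>
  is tied with it. Lying in every prefix of \<open>ts\<close> that contains \<open>xs ! i\<close>
  means not coming later in \<open>ts\<close>; prefixes are used because cores are prefixes.\<close>

definition greedy :: "'a list \<Rightarrow> bool" where
  "greedy xs \<longleftrightarrow> mcs_seq V E xs \<and>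
     (\<forall>i<length xs. \<forall>u\<in>V - pre xs i.
        card (N (xs ! i) \<inter> pre xs i) \<le> card (N u \<inter> pre xs i) \<longrightarrow>
        (\<forall>k. xs ! i \<in> pre ts k \<longrightarrow> u \<in> pre ts k))"

lemma greedy_core:
  assumes "greedy xs" "i < length xs" "u \<in> V - pre xs i" "u \<notin> core m"
    "card (N (xs ! i) \<inter> pre xs i) \<le> card (N u \<inter> pre xs i)"
  shows "xs ! i \<notin> core m"
  using assms core_prefix[of m] unfolding greedy_def by metis


text \<open>A clique of \<open>core n\<close> visited before the first \<open>n\<close>-clique extends to an \<open>n\<close>-clique that is not yet
  visited, so it lies in the separator of the unvisited rest of the core.\<close>

lemma visited_clique_in_separator:
  assumes xs: "mcs_seq V E xs" and n: "n \<ge> 1" and en: "enters xs n i Q"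
    and A: "clique V E A" "A \<subseteq> core n" "A \<subseteq> pre xs i" "card A \<le> n"
  shows "A \<subseteq> N (xs ! i) \<inter> pre xs i"
proof -
  have Q: "Q \<subseteq> core n" "card Q = n"
    and no: "\<And>A. clique V E A \<Longrightarrow> A \<subseteq> core n \<Longrightarrow> card A = n \<Longrightarrow> \<not> A \<subseteq> pre xs i"
    using en by (auto simp: enters_def)
  have "n \<le> card (core n)" using card_mono[OF finite_core Q(1)] Q(2) by simp
  then obtain J where J: "clique V E J" "A \<subseteq> J" "J \<subseteq> core n" "card J = n"
    using extend_clique[OF A(1,2,4), of thesis] by auto
  then obtain p where p: "p \<in> J" "p \<notin> pre xs i" using no by blast
  have "x \<in> N p" if "x \<in> A" for x
    using cliqueD[OF J(1) p(1), of x] J(2) A(3) p(2) that by auto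
  then have "A \<subseteq> \<Union> (N ` (core n - pre xs i)) \<inter> pre xs i" using p J(3) A(3) by blast
  then show ?thesis using enters_separator(4)[OF xs n en] by simp
qed

text \<open>\<open>y\<close> is the vertex of \<open>ts\<close> at which \<open>core n\<close> is
  cut off and \<open>a\<close> is its label. The threshold \<open>Suc a\<close> already stops at the
  same place.\<close>

lemma core_attachment:
  assumes "core n \<noteq> V"
  obtains a y where "a < n" "y \<in> V - core n" "core (Suc a) = core n"
    "clique V E (N y \<inter> core n)" "card (N y \<inter> core n) = a"
proof -
  obtain k where k: "k \<le> length ts" "core n = pre ts k"
    "k < length ts \<Longrightarrow> card (N (ts ! k) \<inter> pre ts k) < min k n"
    using core_prefix by metis
  have kl: "k < length ts" using k(1,2) assms mcs_set[OF ts] by (cases "k = length ts") auto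
  let ?a = "card (N (ts ! k) \<inter> pre ts k)"
  have a: "?a < k" "?a < n" using k(3)[OF kl] by auto
  have y: "ts ! k \<in> V - pre ts k" using mcs_nth[OF ts kl] .
  obtain k' where k': "core (Suc ?a) = pre ts k'"
    "\<And>j. j < k' \<Longrightarrow> min j (Suc ?a) \<le> card (N (ts ! j) \<inter> pre ts j)"
    using core_prefix[of "Suc ?a"] by metis
  have "\<not> k < k'" using k'(2)[of k] a(1) by auto
  then have "core (Suc ?a) \<subseteq> core n" using k'(1) k(2) pre_mono[of k' k ts] by simp
  then have "core (Suc ?a) = core n" using core_antimono[of "Suc ?a" n] a(2) by auto
  then show thesis
    using that[of ?a "ts ! k"] a y k(2) earlier_neighbors_clique[OF ts _ y] kl by auto
qed

section \<open>A greedy second sweep compared with a search ending in the start of the first\<close>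

context
  fixes es :: "'a list" and rs :: "'a list"
  assumes es: "mcs_seq V E es" and es_last: "last es = ts ! 0" and V: "V \<noteq> {}"
    and rs: "greedy rs"
begin

lemma start_in_core: "ts ! 0 \<in> core m"
proof -
  have "0 < length ts" using V mcs_set[OF ts] by auto
  then show ?thesis unfolding core_def by auto
qed

lemma es_late: "m \<ge> 1 \<Longrightarrow> enters es m i Q \<Longrightarrow> V - core m \<subseteq> pre es i"
  using end_in_core_late[OF es] es_last start_in_core by simp

lemma rs_mcs: "mcs_seq V E rs"
  using rs by (simp add: greedy_def)

text \<open>Visited neighbours of \<open>p\<close> lie in the separator, which is part of the core.
  Unvisited ones lie in the core because everything outside has been visited.\<close>

lemma es_remainder:
  assumes "m \<ge> 1" "enters es m i Q" "p \<in> core m" "p \<notin> pre es i"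
  shows "N p \<subseteq> core m"
proof
  fix x assume x: "x \<in> N p"
  show "x \<in> core m"
  proof (cases "x \<in> pre es i")
    case True
    then have "x \<in> \<Union> (N ` (core m - pre es i)) \<inter> pre es i" using x assms by auto
    then show ?thesis using enters_separator(1,4)[OF es assms(1,2)] by auto
  next
    case False
    then show ?thesis using x N_subset es_late[OF assms(1,2)] by auto
  qed
qed

text \<open>A property of \<open>n\<close>-cliques of \<open>core n\<close> is percolated from
  \<open>T0\<close>: those visited by \<open>es\<close> before step \<open>r\<close> have been
  visited by \<open>rs\<close> before step \<open>i\<close>. A vertex of \<open>core n\<close>
  outside \<open>core (Suc n)\<close> lies only in \<open>n\<close>-cliques of the former
  kind.\<close>

lemma common_clique_late:
  assumes n: "n \<ge> 1"
    and R: "enters es (Suc n) r QR"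
    and W: "enters rs (Suc n) i Q"
    and low: "\<And>u. u \<in> V - core (Suc n) - pre rs i \<Longrightarrow> card (N u \<inter> pre rs i) < n"
    and T0: "clique V E T0" "T0 \<subseteq> core n" "card T0 = n" "T0 \<subseteq> pre es r" "T0 \<subseteq> pre rs i"
  shows "core n - core (Suc n) \<subseteq> pre rs i"
proof
  fix u assume u: "u \<in> core n - core (Suc n)"
  let ?R = "pre es r" and ?W = "pre rs i"
  let ?SR = "N (es ! r) \<inter> ?R" and ?S = "N (rs ! i) \<inter> ?W"
  note sepR = enters_separator[OF es _ R, simplified]
  note sepW = enters_separator[OF rs_mcs _ W, simplified]
  have VR: "V - core (Suc n) \<subseteq> ?R" using es_late[OF _ R] by simp
  have noR: "\<not> A \<subseteq> ?R" if "clique V E A" "A \<subseteq> core (Suc n)" "card A = Suc n" for A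
    using R that by (auto simp: enters_def)
  \<comment> \<open>Percolation can pass between cliques inside \<open>?R\<close> and cliques
    reaching outside \<open>?R\<close> only through the separator \<open>?SR\<close>.\<close>
  have crossing: "A = ?SR" if J: "clique V E J" "J \<subseteq> core n" "A \<subseteq> J" "card A = n" "A \<subseteq> ?R"
    "p \<in> J" "p \<notin> ?R" for J A p
  proof (rule card_seteq)
    have "p \<in> V" using J(2,6) core_subset by blast
    then have "p \<in> core (Suc n) - ?R" using J(7) VR by blast
    moreover have "A \<subseteq> N p" using cliqueD[OF J(1,6)] J(3,5,7) by blast
    ultimately show "A \<subseteq> ?SR" using sepR(4) J(5) by blast
    show "card ?SR \<le> card A" using sepR(2) J(4) by simp
  qed simp
  \<comment> \<open>While percolation runs through cliques that leave \<open>?R\<close>, the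
    property remembers that \<open>?SR\<close>, through which it must return, is contained in
    \<open>?W\<close>.\<close>
  define \<Phi> where "\<Phi> A \<longleftrightarrow> (if A \<subseteq> ?R then A \<subseteq> ?W else ?SR \<subseteq> ?W)" for A
  \<comment> \<open>An \<open>x\<close> in \<open>B\<close> missed by \<open>rs\<close> sees the
    \<open>n\<close> visited vertices of \<open>A\<close>. By \<open>low\<close> it is in
    \<open>core (Suc n)\<close>, so \<open>A\<close> is the separator of \<open>rs\<close>. Then
    \<open>J\<close> is an \<open>(n+1)\<close>-clique of \<open>core (Suc n)\<close> inside
    \<open>?R\<close>, which \<open>es\<close> has not yet completed.\<close>
  have inside: "B \<subseteq> ?W" if J: "clique V E J" "J \<subseteq> core n" "card J = Suc n" "A \<subseteq> J" "B \<subseteq> J"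
    "card A = n" "A \<subseteq> ?R" "B \<subseteq> ?R" "A \<subseteq> ?W" for J A B
  proof (rule subsetI, rule ccontr)
    fix x assume x: "x \<in> B" "x \<notin> ?W"
    have xA: "x \<notin> A" using x J(9) by auto
    have fJ: "finite J" using clique_finite[OF J(1)] .
    have "card (insert x A) = Suc n" using xA J(4,6) fJ finite_subset by (metis card_insert_disjoint)
    then have Jeq: "J = insert x A" using card_seteq[OF fJ, of "insert x A"] x(1) J(3-5) by auto
    then have "\<not> J \<subseteq> core (Suc n)" using noR[OF J(1) _ J(3)] x(1) J(7,8) by auto
    have AN: "A \<subseteq> N x" using cliqueD[OF J(1), of x] Jeq xA by blast
    then have "n \<le> card (N x \<inter> ?W)" using card_mono[of "N x \<inter> ?W" A] J(6,9) by auto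
    then have xc: "x \<in> core (Suc n)" using low[of x] x J(2,5) core_subset by fastforce
    then have "A \<subseteq> ?S" using sepW(4) AN x(2) J(9) by blast
    then have "A = ?S" using card_seteq[of ?S A] sepW(2) J(6) by simp
    then show False using \<open>\<not> J \<subseteq> core (Suc n)\<close> Jeq xc sepW(1) by auto
  qed
  have "n \<le> card (core n)" using card_mono[OF finite_core T0(2)] T0(3) by simp
  then obtain J where J: "clique V E J" "u \<in> J" "J \<subseteq> core n" "card J = n"
    using core_vertex_clique[of u n n thesis] u n by auto
  have "\<Phi> J"
  proof (rule percolation[of n \<Phi> T0 J])
    show "\<Phi> T0" using T0 by (simp add: \<Phi>_def)
    fix J A B
    assume J: "clique V E J" "J \<subseteq> core n" "card J = Suc n" "A \<subseteq> J" "B \<subseteq> J" "card A = n" "card B = n"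
      and A: "\<Phi> A"
    show "\<Phi> B"
    proof (cases "A \<subseteq> ?R"; cases "B \<subseteq> ?R")
      assume "A \<subseteq> ?R" "B \<subseteq> ?R"
      then show ?thesis using inside[OF J(1-6)] A by (simp add: \<Phi>_def)
    next
      assume AB: "A \<subseteq> ?R" "\<not> B \<subseteq> ?R"
      then obtain p where "p \<in> J" "p \<notin> ?R" using J(4,5) by blast
      then have "A = ?SR" using crossing[OF J(1,2,4,6) AB(1)] by simp
      then show ?thesis using A AB by (simp add: \<Phi>_def)
    next
      assume AB: "\<not> A \<subseteq> ?R" "B \<subseteq> ?R"
      then obtain p where "p \<in> J" "p \<notin> ?R" using J(4,5) by blast
      then have "B = ?SR" using crossing[OF J(1,2,5,7) AB(2)] by simp
      then show ?thesis using A AB by (simp add: \<Phi>_def)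
    next
      assume "\<not> A \<subseteq> ?R" "\<not> B \<subseteq> ?R"
      then show ?thesis using A by (simp add: \<Phi>_def)
    qed
  qed (fact T0 J)+
  \<comment> \<open>A vertex of \<open>J\<close> unvisited by \<open>es\<close> would have all its
    neighbours in \<open>core (Suc n)\<close>, but \<open>u\<close> is one of them.\<close>
  moreover have "J \<subseteq> ?R"
  proof (rule subsetI, rule ccontr)
    fix p assume p: "p \<in> J" "p \<notin> ?R"
    have "u \<in> ?R" using u VR core_subset by auto
    then have "u \<in> N p" using cliqueD[OF J(1) p(1) J(2)] p(2) by auto
    moreover have "p \<in> core (Suc n)" using p J(3) VR core_subset by auto
    ultimately show False using es_remainder[OF _ R, of p] p(2) u by auto
  qed
  ultimately show "u \<in> ?W" using J(2) by (auto simp: \<Phi>_def)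
qed

text \<open>If \<open>Q1\<close> is not contained in \<open>core (Suc n)\<close>, a vertex of
  \<open>Q1\<close> serves. Otherwise the vertex that \<open>es\<close> visits next does: it sees
  all of \<open>Q1\<close>, and if it were in \<open>core (Suc n)\<close>, an
  \<open>(n+1)\<close>-clique of that core would be completed while \<open>u\<close> is still
  unvisited, against \<open>es_late\<close>.\<close>

lemma outer_neighbor:
  assumes n: "n \<ge> 1" and ne: "\<not> core n \<subseteq> core (Suc n)"
    and Q1: "enters es n i Q1"
  obtains w where "w \<in> core n - core (Suc n)" "Q1 - {w} \<subseteq> N w"
proof (cases "Q1 \<subseteq> core (Suc n)")
  case False
  then obtain w where w: "w \<in> Q1" "w \<notin> core (Suc n)" by auto
  moreover have "clique V E Q1" "Q1 \<subseteq> core n" using Q1 by (auto simp: enters_def)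
  ultimately show thesis using that[of w] cliqueD[of V E Q1 w] by auto
next
  case True
  let ?v = "es ! i" and ?W = "pre es (Suc i)"
  note sep = enters_separator[OF es n Q1]
  have i: "i < length es" and Q: "clique V E Q1" "Q1 \<subseteq> core n" "card Q1 = n" "Q1 \<subseteq> ?W"
    using Q1 by (auto simp: enters_def)
  have W: "?W = insert ?v (pre es i)" using pre_Suc[OF i] .
  obtain u where u: "u \<in> core n" "u \<notin> core (Suc n)" using ne by auto
  have uV: "u \<in> V" using u core_subset by auto
  \<comment> \<open>Visited earlier, \<open>u\<close> would lie in the separator and thus in
    \<open>Q1\<close>, which is inside \<open>core (Suc n)\<close>.\<close>
  have uW: "u \<notin> ?W"
  proof
    assume "u \<in> ?W"
    moreover have "u \<noteq> ?v" using u True sep(3) by auto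
    ultimately have "u \<in> pre es i" using W by auto
    then have "{u} \<subseteq> N ?v \<inter> pre es i"
      using visited_clique_in_separator[OF es n Q1, of "{u}"] u n uV by (auto simp: clique_def)
    then show False using sep(3) True u(2) by auto
  qed
  then have si: "Suc i < length es"
    using uV mcs_set[OF es] i by (cases "Suc i = length es") auto
  let ?y = "es ! Suc i"
  let ?D = "N ?y \<inter> ?W"
  have y: "?y \<in> V - ?W" using mcs_nth[OF es si] .
  have "\<not> core n \<subseteq> ?W" using u uW by auto
  then obtain x where x: "x \<in> core n - ?W" "n \<le> card (N x \<inter> ?W)"
    using core_finishes[OF Q n] by auto
  then have cD: "n \<le> card ?D" using mcs_label[OF es si, of x] core_subset by force
  have D: "clique V E ?D" using earlier_neighbors_clique[OF es _ y] si by simp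
  have "card (N ?y \<inter> pre es i) \<le> card (N ?v \<inter> pre es i)" using mcs_label[OF es i, of ?y] y W by auto
  then have "card (N ?y \<inter> pre es i) < card ?D" using sep(2) cD by simp
  then have "\<not> ?D \<subseteq> N ?y \<inter> pre es i" using card_mono[of "N ?y \<inter> pre es i" ?D] by auto
  \<comment> \<open>The label of \<open>?y\<close> was at most \<open>n - 1\<close> before
    \<open>?v\<close> was visited and is now at least \<open>n\<close>. As \<open>?D\<close> is a
    clique containing \<open>?v\<close>, its other members are in the separator.\<close>
  then have vD: "?v \<in> ?D" using W by auto
  have "?D \<subseteq> Q1"
  proof
    fix d assume d: "d \<in> ?D"
    show "d \<in> Q1"
    proof (cases "d = ?v")
      case False
      then show ?thesis using cliqueD[OF D vD d] d W sep(3) by auto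
    qed (use sep(3) in auto)
  qed
  then have "?D = Q1" using card_seteq[OF clique_finite[OF Q(1)]] cD Q(3) by auto
  then have yQ: "Q1 \<subseteq> N ?y" by auto
  have yn: "?y \<in> core n" using es_late[OF n Q1] y W by auto
  show thesis
  proof (cases "?y \<in> core (Suc n)")
    case False
    then show thesis using that[of ?y] yn yQ by auto
  next
    case ys: True
    have "clique V E (insert ?y Q1)" using clique_insert[OF Q(1) _ yQ] y by auto
    moreover have "insert ?y Q1 \<subseteq> core (Suc n)" using ys True by auto
    moreover have "?y \<notin> Q1" using y Q(4) by blast
    then have "card (insert ?y Q1) = Suc n" using Q(3) clique_finite[OF Q(1)] by simp
    moreover have "insert ?y Q1 \<subseteq> pre es (Suc (Suc i))" using Q(4) pre_Suc[OF si] by auto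
    ultimately obtain j Q2 where j: "j < Suc (Suc i)" "enters es (Suc n) j Q2"
      using enters_exists[of "insert ?y Q1" "Suc n" "Suc (Suc i)" es thesis] si by auto
    then have "u \<in> pre es j" using es_late[of "Suc n" j Q2] u uV by auto
    then show thesis using uW pre_mono[of j "Suc i" es] j(1) by auto
  qed
qed

text \<open>Suppose \<open>u\<close> is left over. With \<open>n = m - 1\<close>, the sweep
  \<open>rs\<close> has entered \<open>core n\<close> before through a clique \<open>Q'\<close>, and
  by induction \<open>u\<close> is in \<open>core n\<close>. If \<open>Q'\<close> is not contained
  in \<open>core m\<close>, then \<open>es\<close> has visited \<open>Q'\<close> as well when it
  enters \<open>core m\<close>, and \<open>common_clique_late\<close> shows that \<open>u\<close>
  has been visited.\<close>

lemma rs_late: "m \<ge> 1 \<Longrightarrow> enters rs m i Q \<Longrightarrow> V - core m \<subseteq> pre rs i"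
proof (induction m arbitrary: i Q rule: less_induct)
  case (less m)
  let ?W = "pre rs i" and ?v = "rs ! i"
  note sep = enters_separator[OF rs_mcs less.prems]
  have i: "i < length rs" and Q: "clique V E Q" "Q \<subseteq> core m" "card Q = m" "Q \<subseteq> pre rs (Suc i)"
    using less.prems by (auto simp: enters_def)
  show ?case
  proof (rule ccontr)
    assume "\<not> ?case"
    then obtain u where u: "u \<in> V" "u \<notin> core m" "u \<notin> ?W" by auto
    have vm: "?v \<in> core m" using sep(3) Q(2) by auto
    \<comment> \<open>\<open>?v\<close> has label \<open>m - 1\<close>. An unvisited vertex outside
      \<open>core m\<close> with at least this label would be tied with \<open>?v\<close> and
      preferred to it.\<close>
    have low: "Suc (card (N x \<inter> ?W)) < m" if "x \<in> V - core m - ?W" for x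
      using greedy_core[OF rs i, of x m] that vm sep(2) by (meson DiffE DiffI Suc_leI less_Suc_eq_le not_less_eq not_le)
    define n where "n = m - 1"
    have m: "m = Suc n" and n: "n \<ge> 1" using low[of u] u by (auto simp: n_def)
    have low': "card (N x \<inter> ?W) < n" if "x \<in> V - core (Suc n) - ?W" for x
      using low[of x] that m by simp
    let ?S = "N ?v \<inter> ?W"
    have S: "clique V E ?S" "?S \<subseteq> core n" "card ?S = n"
      using sep(1,2) m core_antimono[of n m] clique_subset[OF Q(1), of ?S] sep(3) by auto
    obtain i' Q' where i': "i' < i" "enters rs n i' Q'"
      using enters_exists[OF S _ less_imp_le[OF i] n, of thesis] by auto
    have Q': "clique V E Q'" "Q' \<subseteq> core n" "card Q' = n" "Q' \<subseteq> ?W"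
      using i' pre_mono[of "Suc i'" i rs] by (auto simp: enters_def)
    have "V - core n \<subseteq> pre rs i'" using less.IH[OF _ n i'(2)] m by simp
    then have "u \<in> core n" using u pre_mono[of i' i rs] i'(1) by auto
    obtain r QR where R: "enters es m r QR"
      using enters_exists_seq[OF es Q(1-3) less.prems(1), of thesis] by auto
    have VR: "V - core m \<subseteq> pre es r" using es_late[OF less.prems(1) R] .
    have "\<not> Q' \<subseteq> core m"
    proof (cases "core n = V")
      case True
      have l0: "0 < length rs" using i by linarith
      \<comment> \<open>At the start all labels are \<open>0\<close>, so \<open>u\<close> is tied
        with every vertex of \<open>core m\<close>.\<close>
      then have r0: "rs ! 0 \<notin> core m" using greedy_core[OF rs, of 0 u m] u by simp
      have "rs ! 0 \<in> Q'"
      proof (cases "i' = 0")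
        case False
        then have "rs ! 0 \<in> pre rs i'" using pre_conv[of i' rs "rs ! 0"] i' i by auto
        moreover have "clique V E {rs ! 0}" "{rs ! 0} \<subseteq> core n"
          using True mcs_nth[OF rs_mcs l0] by (auto simp: clique_def)
        ultimately have "{rs ! 0} \<subseteq> N (rs ! i') \<inter> pre rs i'"
          using visited_clique_in_separator[OF rs_mcs n i'(2), of "{rs ! 0}"] n by simp
        then show ?thesis using enters_separator(3)[OF rs_mcs n i'(2)] by auto
      qed (use enters_separator(3)[OF rs_mcs n i'(2)] in auto)
      then show ?thesis using r0 by auto
    next
      case False
      obtain a y where ay: "a < n" "y \<in> V - core n" "core (Suc a) = core n"
        "clique V E (N y \<inter> core n)" "card (N y \<inter> core n) = a"
        using core_attachment[OF False] by metis
      let ?M = "N y \<inter> core n"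
      \<comment> \<open>An unvisited vertex of \<open>?M\<close> would put its neighbour
        \<open>y\<close>, visited because it is outside the core, into the separator, which lies
        inside the core. So \<open>?M\<close> is a visited clique and belongs to the
        separator.\<close>
      have M: "?M \<subseteq> N (xs ! j) \<inter> pre xs j"
        if xs: "mcs_seq V E xs" and b: "b \<ge> 1" "core b = core n" "a \<le> b" and en: "enters xs b j A"
          and late: "V - core b \<subseteq> pre xs j" for xs b j A
      proof -
        have "x \<in> pre xs j" if x: "x \<in> ?M" for x
        proof (rule ccontr)
          assume "x \<notin> pre xs j"
          moreover have "y \<in> pre xs j" "y \<in> N x" using late ay b x neighbors_sym by fast+
          ultimately have "y \<in> N (xs ! j) \<inter> pre xs j"
            using enters_separator(4)[OF xs b(1) en] b x by blast
          then show False using enters_separator(1)[OF xs b(1) en] ay b by auto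
        qed
        then show ?thesis
          using visited_clique_in_separator[OF xs b(1) en ay(4)] ay(5) b by auto
      qed
      \<comment> \<open>Any \<open>Suc a\<close> vertices of \<open>Q'\<close> show that
        \<open>core (Suc a)\<close>, the same set as \<open>core n\<close>, is entered at some
        \<open>i0\<close> not after \<open>i'\<close>.\<close>
      obtain A where A: "A \<subseteq> Q'" "card A = Suc a" "clique V E A"
        using obtain_subset_with_card_n[of "Suc a" Q'] Q' ay(1) clique_subset by (metis Suc_leI)
      have Ac: "A \<subseteq> core (Suc a)" "A \<subseteq> pre rs (Suc i')"
        using A Q' ay(3) i'(2) by (auto simp: enters_def)
      obtain i0 Q0 where i0: "i0 < Suc i'" "enters rs (Suc a) i0 Q0"
        using enters_exists[OF A(3) Ac(1) A(2) Ac(2), of thesis] i' i by auto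
      note sep0 = enters_separator[OF rs_mcs _ i0(2), simplified]
      have late0: "V - core (Suc a) \<subseteq> pre rs i0" using less.IH[OF _ _ i0(2)] ay(1) m by simp
      have "?M \<subseteq> N (rs ! i0) \<inter> pre rs i0" using M[OF rs_mcs _ ay(3) _ i0(2) late0] by simp
      then have M0: "?M = N (rs ! i0) \<inter> pre rs i0"
        using card_seteq[of "N (rs ! i0) \<inter> pre rs i0" ?M] sep0(2) ay(5) by simp
      then have Q0: "Q0 = insert (rs ! i0) ?M" using sep0(3) by simp
      have il: "i0 < length rs" and Q0': "clique V E Q0" "Q0 \<subseteq> core n" "card Q0 = Suc a"
        and no0: "\<And>A. clique V E A \<Longrightarrow> A \<subseteq> core n \<Longrightarrow> card A = Suc a \<Longrightarrow> \<not> A \<subseteq> pre rs i0"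
        using i0 ay(3) by (auto simp: enters_def)
      obtain i1 Q1 where Q1: "enters es n i1 Q1"
        using enters_exists_seq[OF es S n, of thesis] by auto
      have M1: "?M \<subseteq> Q1"
        using M[OF es n refl _ Q1 es_late[OF n Q1]] ay(1) enters_separator(3)[OF es n Q1] by auto
      obtain w where w: "w \<in> core n - core m" "Q1 - {w} \<subseteq> N w"
        using outer_neighbor[OF n _ Q1, of thesis] \<open>u \<in> core n\<close> u(2) m by auto
      \<comment> \<open>At step \<open>i0\<close> the vertex \<open>w\<close> sees the whole
        separator \<open>?M\<close> and is unvisited, so it is tied with \<open>rs ! i0\<close>.
        Lying outside \<open>core m\<close>, it forces \<open>rs ! i0\<close> outside as
        well.\<close>
      have "\<not> Q0 \<subseteq> core m"
      proof
        assume Qm: "Q0 \<subseteq> core m"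
        then have wM: "w \<notin> ?M" using Q0 w(1) by auto
        then have Mw: "?M \<subseteq> N w" using M1 w(2) by auto
        have wV: "w \<in> V" using w(1) core_subset by auto
        have "w \<notin> pre rs i0"
        proof
          assume "w \<in> pre rs i0"
          then have "insert w ?M \<subseteq> pre rs i0" using M0 by auto
          moreover have "clique V E (insert w ?M)" using clique_insert[OF ay(4) wV Mw] .
          moreover have "card (insert w ?M) = Suc a" using wM ay(5) finite_N by simp
          ultimately show False using no0[of "insert w ?M"] w(1) by auto
        qed
        moreover have "?M \<subseteq> N w \<inter> pre rs i0" using Mw M0 by auto
        then have "card (N (rs ! i0) \<inter> pre rs i0) \<le> card (N w \<inter> pre rs i0)"
          using M0 by (metis card_mono finite_Int finite_N)
        ultimately show False using greedy_core[OF rs il, of w m] w(1) wV Qm Q0 by auto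
      qed
      moreover have "Q0 \<subseteq> Q'"
      proof (cases "i0 = i'")
        case True
        then show ?thesis
          using sep0(3) enters_separator(3)[OF rs_mcs n i'(2)] by simp
      next
        case False
        then have "pre rs (Suc i0) \<subseteq> pre rs i'" using i0(1) pre_mono[of "Suc i0" i' rs] by simp
        then have "Q0 \<subseteq> pre rs i'" using i0(2) by (auto simp: enters_def)
        then show ?thesis
          using visited_clique_in_separator[OF rs_mcs n i'(2) Q0'(1,2)] Q0'(3) ay(1)
            enters_separator(3)[OF rs_mcs n i'(2)] by auto
      qed
      ultimately show ?thesis by auto
    qed
    then obtain w where w: "w \<in> Q'" "w \<notin> core m" by auto
    \<comment> \<open>An unvisited vertex of \<open>Q'\<close> would have all its neighbours in
      \<open>core m\<close> by \<open>es_remainder\<close>, but \<open>w\<close> is one of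
      them.\<close>
    have "Q' \<subseteq> pre es r"
    proof (rule subsetI, rule ccontr)
      fix p assume p: "p \<in> Q'" "p \<notin> pre es r"
      have "w \<in> pre es r" using w Q' VR core_subset by blast
      then have "w \<in> N p" using cliqueD[OF Q'(1) p(1) w(1)] p(2) by auto
      moreover have "p \<in> core m" using p Q'(2) VR core_subset by blast
      ultimately show False using es_remainder[OF less.prems(1) R, of p] p(2) w(2) by auto
    qed
    then have "core n - core (Suc n) \<subseteq> ?W"
      using common_clique_late[OF n _ _ low' Q'(1-3) _ Q'(4), of r QR Q] R less.prems(2) m by simp
    then show False using \<open>u \<in> core n\<close> u m by auto
  qed
qed

text \<open>All neighbours of the last vertex of \<open>es\<close> are earlier neighbours, which
  form a clique.\<close>

lemma end_vertex_simplicial: "clique V E (insert (ts ! 0) (N (ts ! 0)))"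
proof -
  let ?z = "ts ! 0" and ?l = "length es - 1"
  have "es \<noteq> []" using V mcs_set[OF es] by auto
  then have l: "?l < length es" and last: "es ! ?l = ?z" using es_last by (simp_all add: last_conv_nth)
  have "V = insert ?z (pre es ?l)"
    using mcs_set[OF es] pre_Suc[OF l] last l by simp
  then have "N ?z \<subseteq> pre es ?l" using N_subset[of ?z] N_irrefl[of ?z] by auto
  moreover have "clique V E (N ?z \<inter> pre es ?l)"
    using earlier_neighbors_clique[OF es _ mcs_nth[OF es l]] l last by simp
  ultimately have "clique V E (N ?z)" by (simp add: Int_absorb2)
  then show ?thesis using mcs_nth[OF es l] last by (intro clique_insert) auto
qed

text \<open>The first sweep starts in \<open>?z\<close> and exhausts the clique \<open>?K\<close>
  first. Behind it, a label as large as \<open>card ?K\<close> would mean adjacency to every earlier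
  vertex, including \<open>?z\<close>.\<close>

lemma core_degree: "core (Suc (card (N (ts ! 0)))) = insert (ts ! 0) (N (ts ! 0))"
proof -
  let ?z = "ts ! 0"
  let ?K = "insert ?z (N ?z)"
  let ?m = "card ?K"
  have m: "?m = Suc (card (N ?z))" using N_irrefl finite_N by simp
  have K: "clique V E ?K" using end_vertex_simplicial .
  have KV: "?K \<subseteq> V" using K by (simp add: clique_def)
  have lm: "?m \<le> length ts"
    using card_mono[OF finite_V KV] distinct_card[OF mcs_distinct[OF ts]] mcs_set[OF ts] by simp
  \<comment> \<open>Any unvisited vertex \<open>x\<close> of the clique \<open>?K\<close> has the
    largest possible label \<open>j\<close>.\<close>
  have grow: "j \<le> card (N (ts ! j) \<inter> pre ts j)" if j: "j < ?m" "pre ts j \<subseteq> ?K" for j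
  proof -
    have cj: "card (pre ts j) = j" using card_pre[OF mcs_distinct[OF ts], of j] j lm by simp
    then have "pre ts j \<noteq> ?K" using j(1) by auto
    then obtain x where x: "x \<in> ?K" "x \<notin> pre ts j" using j(2) by auto
    have "pre ts j \<subseteq> N x \<inter> pre ts j"
    proof
      fix q assume "q \<in> pre ts j"
      then show "q \<in> N x \<inter> pre ts j" using cliqueD[OF K x(1), of q] x(2) j(2) by auto
    qed
    then have "j \<le> card (N x \<inter> pre ts j)" using card_mono[of "N x \<inter> pre ts j" "pre ts j"] cj by simp
    then show ?thesis using mcs_label[OF ts, of j x] x KV j(1) lm by auto
  qed
  have adj_all: "ts ! j \<in> ?K" if j: "j < length ts" "j \<le> card (N (ts ! j) \<inter> pre ts j)" for j
  proof (cases j)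
    case (Suc j')
    have "N (ts ! j) \<inter> pre ts j = pre ts j"
      using card_seteq[of "pre ts j" "N (ts ! j) \<inter> pre ts j"] j
        card_pre[OF mcs_distinct[OF ts], of j] by simp
    moreover have "?z \<in> pre ts j" using Suc j(1) pre_conv[of j ts ?z] by auto
    ultimately show ?thesis using neighbors_sym by fast
  qed simp
  have sub: "j \<le> ?m \<Longrightarrow> pre ts j \<subseteq> ?K" for j
  proof (induction j)
    case (Suc j)
    then show ?case using grow[of j] adj_all[of j] pre_Suc[of j ts] lm by auto
  qed simp
  have eq: "pre ts ?m = ?K"
    using card_seteq[OF _ sub[of ?m]] card_pre[OF mcs_distinct[OF ts] lm] finite_N by simp
  obtain k where k: "k \<le> length ts" "core ?m = pre ts k"
    "\<And>j. j < k \<Longrightarrow> min j ?m \<le> card (N (ts ! j) \<inter> pre ts j)"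
    "k < length ts \<Longrightarrow> card (N (ts ! k) \<inter> pre ts k) < min k ?m"
    using core_prefix by metis
  have "\<not> k < ?m"
  proof
    assume "k < ?m"
    then show False using k(4) grow[of k] sub[of k] lm by simp
  qed
  moreover have "\<not> ?m < k"
  proof
    assume *: "?m < k"
    then have "ts ! ?m \<in> ?K" using k(1) k(3)[of ?m] adj_all[of ?m] by simp
    then show False using eq nth_notin_pre[OF mcs_distinct[OF ts], of ?m] * k(1) by simp
  qed
  ultimately have "core ?m = pre ts ?m" using k(2) by simp
  then show ?thesis using eq m by simp
qed

text \<open>\<open>core ?m\<close> is the clique \<open>?K\<close>, so its only
  \<open>?m\<close>-clique is completed by its last vertex, and by \<open>rs_late\<close> nothing
  else remains then. Inside \<open>?K\<close> the vertex \<open>?z\<close> has the lowest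
  priority.\<close>

lemma greedy_last: "last rs = ts ! 0"
proof -
  let ?z = "ts ! 0"
  let ?K = "insert ?z (N ?z)"
  let ?m = "Suc (card (N ?z))"
  have K: "clique V E ?K" "core ?m = ?K" "card ?K = ?m"
    using end_vertex_simplicial core_degree N_irrefl finite_N by auto
  obtain i Q where en: "enters rs ?m i Q"
    by (rule enters_exists_seq[OF rs_mcs K(1) _ K(3)]) (use K(2) that in auto)
  have i: "i < length rs" and "Q \<subseteq> ?K" "card Q = ?m" and QW: "Q \<subseteq> pre rs (Suc i)"
    using en K(2) by (auto simp: enters_def)
  then have "Q = ?K" using card_seteq[of ?K Q] K(3) finite_N by simp
  have "V - ?K \<subseteq> pre rs i" using rs_late[OF _ en] K(2) by simp
  then have Vsub: "V \<subseteq> pre rs (Suc i)" using QW \<open>Q = ?K\<close> pre_mono[of i "Suc i" rs] by auto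
  have "\<not> Suc i < length rs" using mcs_nth[OF rs_mcs, of "Suc i"] Vsub by auto
  then have l: "Suc i = length rs" using i by simp
  then have last: "last rs = rs ! i" using last_conv_nth[of rs] by (cases rs) auto
  have vK: "rs ! i \<in> ?K" using enters_separator(3)[OF rs_mcs _ en] \<open>Q = ?K\<close> by auto
  have "rs ! i = ?z"
  proof (rule ccontr)
    assume ne: "rs ! i \<noteq> ?z"
    have "?z \<in> V" using K(1) by (simp add: clique_def)
    then obtain j where j: "j < length rs" "rs ! j = ?z"
      using mcs_set[OF rs_mcs] by (auto simp: in_set_conv_nth)
    have ji: "j < i" using j l ne by (cases "j = i") auto
    have v: "rs ! i \<in> V - pre rs j"
      using mcs_nth[OF rs_mcs i] pre_mono[of j i rs] ji by auto
    \<comment> \<open>If \<open>?z\<close> were chosen at \<open>j\<close> before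
      \<open>rs ! i\<close>, then \<open>rs ! i\<close> would have at least the same label there.
      Tie-breaking would put it into \<open>pre ts 1\<close>, which contains only
      \<open>?z\<close>.\<close>
    have "N ?z \<inter> pre rs j \<subseteq> N (rs ! i) \<inter> pre rs j"
    proof
      fix x assume x: "x \<in> N ?z \<inter> pre rs j"
      then have "x \<noteq> rs ! i" using v by auto
      then show "x \<in> N (rs ! i) \<inter> pre rs j" using cliqueD[OF K(1) vK, of x] x by auto
    qed
    then have "card (N (rs ! j) \<inter> pre rs j) \<le> card (N (rs ! i) \<inter> pre rs j)"
      using j(2) by (simp add: card_mono)
    moreover have "rs ! j \<in> pre ts 1"
      using j V mcs_set[OF ts] pre_conv[of 1 ts ?z] by (cases ts) auto
    ultimately have "rs ! i \<in> pre ts 1" using rs j(1) v unfolding greedy_def by blast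
    then show False using ne by (cases ts) auto
  qed
  then show ?thesis using last by simp
qed

end

end

subsection \<open>Cost of programs\<close>

text \<open>Total correctness with an upper bound on the cost, so that bounds may be rounded
  up.\<close>

definition runs :: "nat \<Rightarrow> com \<Rightarrow> state \<Rightarrow> nat \<Rightarrow> (state \<Rightarrow> bool) \<Rightarrow> bool" where
  "runs W c s t Q \<longleftrightarrow> (\<exists>t' s'. exec W c s t' s' \<and> t' \<le> t \<and> Q s')"

lemma runs_mono: "runs W c s t Q \<Longrightarrow> t \<le> t' \<Longrightarrow> (\<And>s'. Q s' \<Longrightarrow> Q' s') \<Longrightarrow> runs W c s t' Q'"
  unfolding runs_def using le_trans by blast

lemma runs_le: "runs W c s t Q \<Longrightarrow> t \<le> t' \<Longrightarrow> runs W c s t' Q"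
  using runs_mono by blast

lemma runs_Skip: "Q s \<Longrightarrow> runs W Skip s 1 Q"
  unfolding runs_def using exec.Skip by blast

lemma runs_Assign:
  "aval e s < W \<Longrightarrow> Q ((fst s)(x := aval e s), snd s) \<Longrightarrow> runs W (Assign x e) s (1 + acost e) Q"
  unfolding runs_def using exec.Assign by blast

lemma runs_Put:
  "aval i s < W \<Longrightarrow> aval e s < W \<Longrightarrow>
     Q (fst s, (snd s)(a := (snd s a)(aval i s := aval e s))) \<Longrightarrow>
     runs W (Put a i e) s (1 + acost i + acost e) Q"
  unfolding runs_def using exec.Put by blast

lemma runs_Seq:
  assumes "runs W c s t1 (\<lambda>s'. runs W d s' t2 Q)"
  shows "runs W (Seq c d) s (t1 + t2) Q"
proof -
  obtain u s' v s'' where "exec W c s u s'" "u \<le> t1" "exec W d s' v s''" "v \<le> t2" "Q s''"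
    using assms(1) unfolding runs_def by blast
  then show ?thesis
    unfolding runs_def by (intro exI[of _ "u + v"] exI[of _ s'']) (auto intro: exec.Seq)
qed

text \<open>Charging both branches keeps the bound a plain sum, without a maximum.\<close>

lemma runs_If:
  assumes "bval b s \<Longrightarrow> runs W c s t1 Q" "\<not> bval b s \<Longrightarrow> runs W d s t2 Q"
  shows "runs W (If b c d) s (1 + bcost b + (t1 + t2)) Q"
proof (cases "bval b s")
  case True
  then obtain u s' where u: "exec W c s u s'" "u \<le> t1" "Q s'" using assms(1) unfolding runs_def by blast
  show ?thesis
    unfolding runs_def using exec.IfTrue[OF True u(1), of d] u(2,3) by fastforce
next
  case False
  then obtain u s' where u: "exec W d s u s'" "u \<le> t2" "Q s'" using assms(2) unfolding runs_def by blast
  show ?thesis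
    unfolding runs_def using exec.IfFalse[OF False u(1), of c] u(2,3) by fastforce
qed

lemmas runs_rules = runs_Seq runs_If runs_Skip runs_Assign runs_Put

text \<open>\<open>I k\<close> describes the state after \<open>k\<close> iterations; the loop makes
  exactly \<open>N\<close> of them.\<close>

lemma runs_While:
  assumes start: "I 0 s"
    and step: "\<And>k s. k < N \<Longrightarrow> I k s \<Longrightarrow> bval b s \<and> runs W c s B (I (Suc k))"
    and stop: "\<And>s. I N s \<Longrightarrow> \<not> bval b s \<and> Q s"
    and t: "N * (1 + bcost b + B) + 1 + bcost b \<le> t"
  shows "runs W (While b c) s t Q"
proof -
  have "I k s \<Longrightarrow> k \<le> N \<Longrightarrow> runs W (While b c) s ((N - k) * (1 + bcost b + B) + 1 + bcost b) Q" for k s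
  proof (induction "N - k" arbitrary: k s)
    case 0
    then have "I N s" by auto
    then have "\<not> bval b s" "Q s" using stop by auto
    then show ?case
      unfolding runs_def using exec.WhileFalse[of b s W c] by fastforce
  next
    case (Suc d)
    then have k: "k < N" "d = N - Suc k" by auto
    obtain u s' where u: "bval b s" "exec W c s u s'" "u \<le> B" "I (Suc k) s'"
      using step[OF k(1) Suc.prems(1)] unfolding runs_def by blast
    obtain v s'' where v: "exec W (While b c) s' v s''" "v \<le> d * (1 + bcost b + B) + 1 + bcost b" "Q s''"
      using Suc.hyps(1)[OF k(2) u(4)] k unfolding runs_def by auto
    have "1 + bcost b + u + v \<le> Suc d * (1 + bcost b + B) + 1 + bcost b" using u(3) v(2) by simp
    then show ?case
      unfolding runs_def Suc.hyps(2)[symmetric] using exec.WhileTrue[OF u(1,2) v(1)] v(3) by blast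
  qed
  from this[of 0 s] show ?thesis using start t by (auto elim: runs_le)
qed

section \<open>The program and its running time\<close>

definition scan :: com where
  "scan =
     While (Less (Var ''u'') (Var ''n''))
       (Seq (If (Conj (Equal (Get ''vis'' (Var ''u'')) (Num 0))
                      (Less (Var ''m'') (Plus (Get ''key'' (Var ''u'')) (Num 1))))
               (Seq (Assign ''b'' (Var ''u'')) (Assign ''m'' (Get ''key'' (Var ''u''))))
               Skip)
            (Assign ''u'' (Plus (Var ''u'') (Num 1))))"

definition update :: com where
  "update =
     While (Less (Var ''u'') (Var ''n''))
       (Seq (Put ''key'' (Var ''u'')
               (Plus (Get ''key'' (Var ''u''))
                  (Times (Get ''adj'' (Plus (Times (Var ''b'') (Var ''n'')) (Var ''u'')))
                     (Plus (Var ''n'') (Num 1)))))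
            (Assign ''u'' (Plus (Var ''u'') (Num 1))))"

definition visit_next :: com where
  "visit_next =
     Seq (Assign ''u'' (Num 0)) (Seq (Assign ''m'' (Num 0)) (Seq scan
     (Seq (Put ''vis'' (Var ''b'') (Num 1)) (Seq (Put ''pos'' (Var ''b'') (Var ''i''))
     (Seq (Assign ''u'' (Num 0)) (Seq update (Assign ''i'' (Plus (Var ''i'') (Num 1)))))))))"

definition sweep :: com where
  "sweep = Seq (Assign ''i'' (Num 0)) (While (Less (Var ''i'') (Var ''n'')) visit_next)"

definition reset :: com where
  "reset =
     Seq (Assign ''u'' (Num 0))
       (While (Less (Var ''u'') (Var ''n''))
         (Seq (Put ''vis'' (Var ''u'') (Num 0))
         (Seq (Put ''key'' (Var ''u'') (Get ''pos'' (Var ''u'')))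
              (Assign ''u'' (Plus (Var ''u'') (Num 1))))))"

text \<open>The key \<open>1\<close> at \<open>z\<close> makes \<open>z\<close> the first choice
  when all labels are \<open>0\<close>. \<open>reset\<close> turns the positions of the first sweep
  into the initial keys of the second, and \<open>b\<close> finally holds the vertex visited
  last.\<close>

definition two_sweeps :: com where
  "two_sweeps =
     Seq (Put ''key'' (Var ''z'') (Num 1)) (Seq sweep (Seq reset (Seq sweep
       (If (Equal (Var ''b'') (Var ''z'')) (Assign ''answer'' (Num 1)) (Assign ''answer'' (Num 0))))))"

text \<open>Invariant of \<open>scan\<close>. The first alternative is the state before any
  unvisited vertex has been met, with \<open>m\<close> still \<open>0\<close>. As the test is
  \<open>m < key + 1\<close>, an unvisited vertex with key \<open>0\<close> is accepted in that
  state too.\<close>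

definition best :: "(string \<Rightarrow> nat \<Rightarrow> nat) \<Rightarrow> nat \<Rightarrow> nat \<Rightarrow> nat \<Rightarrow> bool" where
  "best g k v m \<longleftrightarrow> (\<forall>u<k. g ''vis'' u \<noteq> 0) \<and> m = 0 \<or>
     v < k \<and> g ''vis'' v = 0 \<and> m = g ''key'' v \<and> (\<forall>u<k. g ''vis'' u = 0 \<longrightarrow> g ''key'' u \<le> m)"

lemma best_take: "best g k v m \<Longrightarrow> g ''vis'' k = 0 \<Longrightarrow> m < g ''key'' k + 1 \<Longrightarrow> best g (Suc k) k (g ''key'' k)"
  unfolding best_def by (auto simp: less_Suc_eq)

lemma best_skip: "best g k v m \<Longrightarrow> \<not> (g ''vis'' k = 0 \<and> m < g ''key'' k + 1) \<Longrightarrow> best g (Suc k) v m"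
  unfolding best_def by (auto simp: less_Suc_eq)

lemma runs_scan:
  assumes f: "f ''n'' = n" "f ''u'' = 0" "f ''m'' = 0"
    and W: "n < W" "\<And>u. u < n \<Longrightarrow> g ''key'' u < W"
    and u: "u < n" "g ''vis'' u = 0"
    and Q: "\<And>v m. v < n \<Longrightarrow> g ''vis'' v = 0 \<Longrightarrow> (\<And>u. u < n \<Longrightarrow> g ''vis'' u = 0 \<Longrightarrow> g ''key'' u \<le> g ''key'' v) \<Longrightarrow>
       Q (f(''u'' := n, ''m'' := m, ''b'' := v), g)"
  shows "runs W scan (f, g) (40 * n + 4) Q"
  unfolding scan_def
proof (rule runs_While)
  let ?I = "\<lambda>k s. \<exists>v m. s = (f(''u'' := k, ''m'' := m, ''b'' := v), g) \<and> best g k v m"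
  show "?I 0 (f, g)"
    using f by (intro exI[of _ "f ''b''"] exI[of _ 0]) (auto simp: best_def fun_eq_iff)
  show "\<not> bval (Less (Var ''u'') (Var ''n'')) s \<and> Q s" if s: "?I n s" for s
  proof -
    obtain v m where s: "s = (f(''u'' := n, ''m'' := m, ''b'' := v), g)" "best g n v m" using s by auto
    then show ?thesis using Q[of v m] u f(1) unfolding best_def by auto
  qed
  fix k s assume k: "k < n" and "?I k s"
  then obtain v m where s: "s = (f(''u'' := k, ''m'' := m, ''b'' := v), g)" and b: "best g k v m" by auto
  have vals: "k < W" "Suc k < W" "g ''key'' k < W" using W k by auto
  show "bval (Less (Var ''u'') (Var ''n'')) s \<and>
    runs W (Seq (If (Conj (Equal (Get ''vis'' (Var ''u'')) (Num 0))
                      (Less (Var ''m'') (Plus (Get ''key'' (Var ''u'')) (Num 1))))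
               (Seq (Assign ''b'' (Var ''u'')) (Assign ''m'' (Get ''key'' (Var ''u''))))
               Skip)
            (Assign ''u'' (Plus (Var ''u'') (Num 1)))) s 30 (?I (Suc k))"
  proof
    show "bval (Less (Var ''u'') (Var ''n'')) s" using s k f(1) by simp
    show "runs W (Seq (If (Conj (Equal (Get ''vis'' (Var ''u'')) (Num 0))
                      (Less (Var ''m'') (Plus (Get ''key'' (Var ''u'')) (Num 1))))
               (Seq (Assign ''b'' (Var ''u'')) (Assign ''m'' (Get ''key'' (Var ''u''))))
               Skip)
            (Assign ''u'' (Plus (Var ''u'') (Num 1)))) s 30 (?I (Suc k))"
      apply (rule runs_le)
        apply (rule runs_rules | (simp add: s vals; fail))+
         apply (rule exI[of _ k], rule exI[of _ "g ''key'' k"])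
         apply (use b s in \<open>auto simp: fun_eq_iff intro!: best_take\<close>)[1]
        apply (rule runs_rules | (simp add: s vals; fail))+
        apply (rule exI[of _ v], rule exI[of _ m])
        apply (use b s in \<open>auto simp: fun_eq_iff intro!: best_skip\<close>)[1]
       apply simp
      done
  qed
qed simp

lemma runs_update:
  assumes f: "f ''n'' = n" "f ''u'' = 0" "f ''b'' = v"
    and W: "n < W" "\<And>u. u < n \<Longrightarrow> g ''key'' u + g ''adj'' (v * n + u) * (n + 1) < W"
    and Q: "\<And>h. (\<And>u. u < n \<Longrightarrow> h u = g ''key'' u + g ''adj'' (v * n + u) * (n + 1)) \<Longrightarrow>
       Q (f(''u'' := n), g(''key'' := h))"
  shows "runs W update (f, g) (40 * n + 4) Q"
  unfolding update_def
proof (rule runs_While)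
  let ?h = "\<lambda>k u. if u < k then g ''key'' u + g ''adj'' (v * n + u) * (n + 1) else g ''key'' u"
  let ?I = "\<lambda>k s. s = (f(''u'' := k), g(''key'' := ?h k))"
  show "?I 0 (f, g)" using f by (auto simp: fun_eq_iff)
  show "\<not> bval (Less (Var ''u'') (Var ''n'')) s \<and> Q s" if s: "?I n s" for s
    using s f(1) Q[of "?h n"] by simp
  fix k s assume k: "k < n" and s: "?I k s"
  have vals: "k < W" "Suc k < W" "g ''key'' k + g ''adj'' (v * n + k) * (n + 1) < W" using W k by auto
  show "bval (Less (Var ''u'') (Var ''n'')) s \<and>
    runs W (Seq (Put ''key'' (Var ''u'')
               (Plus (Get ''key'' (Var ''u''))
                  (Times (Get ''adj'' (Plus (Times (Var ''b'') (Var ''n'')) (Var ''u'')))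
                     (Plus (Var ''n'') (Num 1)))))
            (Assign ''u'' (Plus (Var ''u'') (Num 1)))) s 30 (?I (Suc k))"
    using k f(1)
    apply (simp add: s)
    apply (rule runs_le)
      apply (rule runs_rules | (use vals f in \<open>simp add: s; fail\<close>))+
      apply (use f in \<open>auto simp: fun_eq_iff less_Suc_eq\<close>)[1]
     apply simp
    done
qed simp

lemma runs_reset:
  assumes f: "f ''n'' = n" and W: "n < W" "\<And>u. u < n \<Longrightarrow> g ''pos'' u < W"
    and Q: "\<And>h h'. (\<And>u. u < n \<Longrightarrow> h u = g ''pos'' u) \<Longrightarrow> (\<And>u. u < n \<Longrightarrow> h' u = 0) \<Longrightarrow>
       Q (f(''u'' := n), g(''key'' := h, ''vis'' := h'))"
  shows "runs W reset (f, g) (40 * n + 10) Q"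
proof -
  let ?h = "\<lambda>k u. if u < k then g ''pos'' u else g ''key'' u"
  let ?h' = "\<lambda>k u. if u < k then 0 else g ''vis'' u"
  let ?I = "\<lambda>k s. s = (f(''u'' := k), g(''key'' := ?h k, ''vis'' := ?h' k))"
  have loop: "runs W (While (Less (Var ''u'') (Var ''n''))
         (Seq (Put ''vis'' (Var ''u'') (Num 0))
         (Seq (Put ''key'' (Var ''u'') (Get ''pos'' (Var ''u'')))
              (Assign ''u'' (Plus (Var ''u'') (Num 1)))))) (f(''u'' := 0), g) (40 * n + 4) Q"
  proof (rule runs_While[where I = ?I and N = n and B = 30])
    show "?I 0 (f(''u'' := 0), g)" by (auto simp: fun_eq_iff)
    show "\<not> bval (Less (Var ''u'') (Var ''n'')) s \<and> Q s" if s: "?I n s" for s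
      using s f(1) Q[of "?h n" "?h' n"] by simp
    fix k s assume k: "k < n" and s: "?I k s"
    have vals: "k < W" "Suc k < W" "0 < W" "g ''pos'' k < W" using W k by auto
    show "bval (Less (Var ''u'') (Var ''n'')) s \<and>
      runs W (Seq (Put ''vis'' (Var ''u'') (Num 0))
         (Seq (Put ''key'' (Var ''u'') (Get ''pos'' (Var ''u'')))
              (Assign ''u'' (Plus (Var ''u'') (Num 1))))) s 30 (?I (Suc k))"
      using k f(1)
      apply (simp add: s)
      apply (rule runs_le)
        apply (rule runs_rules | (use vals f in \<open>simp add: s; fail\<close>))+
        apply (use f in \<open>auto simp: fun_eq_iff less_Suc_eq\<close>)[1]
       apply simp
      done
  qed simp
  show ?thesis
    unfolding reset_def
    apply (rule runs_le)
      apply (rule runs_Seq, rule runs_Assign)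
       apply (use W in simp)
      apply (simp only: fst_conv snd_conv aval.simps, rule loop)
     apply simp
    done
qed

text \<open>With \<open>p \<le> n\<close>, comparing \<open>p u + label * (n + 1)\<close> is comparing labels and breaking ties by \<open>p\<close>.\<close>

definition prio_seq :: "nat \<Rightarrow> nat set set \<Rightarrow> (nat \<Rightarrow> nat) \<Rightarrow> nat list \<Rightarrow> bool" where
  "prio_seq n E p xs \<longleftrightarrow> distinct xs \<and> set xs \<subseteq> {..<n} \<and>
     (\<forall>j<length xs. \<forall>u\<in>{..<n} - pre xs j.
        p u + card (neighbors E u \<inter> pre xs j) * (n + 1)
          \<le> p (xs ! j) + card (neighbors E (xs ! j) \<inter> pre xs j) * (n + 1))"

lemma prio_seq_snoc:
  assumes "prio_seq n E p xs" "v < n" "v \<notin> set xs"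
    and "\<And>u. u < n \<Longrightarrow> u \<notin> set xs \<Longrightarrow>
      p u + card (neighbors E u \<inter> set xs) * (n + 1) \<le> p v + card (neighbors E v \<inter> set xs) * (n + 1)"
  shows "prio_seq n E p (xs @ [v])"
  using assms unfolding prio_seq_def by (auto simp: less_Suc_eq nth_append)

definition sweep_inv ::
  "nat \<Rightarrow> nat set set \<Rightarrow> nat \<Rightarrow> (nat \<Rightarrow> nat) \<Rightarrow> nat list \<Rightarrow> state \<Rightarrow> bool" where
  "sweep_inv n E z p xs s \<longleftrightarrow> prio_seq n E p xs \<and>
     fst s ''n'' = n \<and> fst s ''z'' = z \<and> fst s ''i'' = length xs \<and> (xs \<noteq> [] \<longrightarrow> fst s ''b'' = last xs) \<and>
     snd s ''adj'' = (\<lambda>q. of_bool ({q div n, q mod n} \<in> E)) \<and>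
     (\<forall>u<n. snd s ''vis'' u = of_bool (u \<in> set xs)) \<and>
     (\<forall>u<n. snd s ''key'' u = p u + card (neighbors E u \<inter> set xs) * (n + 1)) \<and>
     (\<forall>j<length xs. snd s ''pos'' (xs ! j) = j)"

lemma runs_visit_next:
  assumes inv: "sweep_inv n E z p xs s" and len: "length xs < n" and p: "\<And>u. u < n \<Longrightarrow> p u \<le> n"
  shows "runs ((n + 2)\<^sup>2) visit_next s (80 * n + 40) (\<lambda>s'. \<exists>v. sweep_inv n E z p (xs @ [v]) s')"
proof -
  obtain f g where s: "s = (f, g)" by (cases s)
  let ?W = "(n + 2)\<^sup>2"
  have f: "f ''n'' = n" "f ''z'' = z" "f ''i'' = length xs"
    and adj: "g ''adj'' = (\<lambda>q. of_bool ({q div n, q mod n} \<in> E))"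
    and vis: "\<And>u. u < n \<Longrightarrow> g ''vis'' u = of_bool (u \<in> set xs)"
    and key: "\<And>u. u < n \<Longrightarrow> g ''key'' u = p u + card (neighbors E u \<inter> set xs) * (n + 1)"
    and pos: "\<And>j. j < length xs \<Longrightarrow> g ''pos'' (xs ! j) = j"
    and xs: "prio_seq n E p xs"
    using inv by (auto simp: sweep_inv_def s)
  have "card (set xs) < n" using len card_length[of xs] by simp
  then have "\<not> {..<n} \<subseteq> set xs" using card_mono[of "set xs" "{..<n}"] by auto
  then obtain u0 where u0: "u0 < n" "u0 \<notin> set xs" by auto
  \<comment> \<open>Priorities and labels are at most \<open>n\<close>, so keys stay below
    \<open>n + n * (n + 1) + 1\<close>. The case \<open>c = 0\<close> is the present key, and
    \<open>c = 1\<close> allows for the increment by \<open>update\<close>.\<close>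
  have bound: "g ''key'' u + c * (n + 1) < ?W" if "u < n" "c \<le> 1" for u c
  proof -
    have "card (neighbors E u \<inter> set xs) \<le> length xs"
      by (rule order_trans[OF card_mono card_length]) auto
    then have "card (neighbors E u \<inter> set xs) + c \<le> n" using len that by simp
    then have "(card (neighbors E u \<inter> set xs) + c) * (n + 1) \<le> n * (n + 1)" by (rule mult_le_mono1)
    then have "g ''key'' u + c * (n + 1) \<le> n + n * (n + 1)"
      using key[OF that(1)] p[OF that(1)] by (simp add: algebra_simps)
    also have "\<dots> < ?W" by (simp add: power2_eq_square)
    finally show ?thesis .
  qed
  have W: "n < ?W" "0 < ?W" "1 < ?W" by (simp_all add: power2_eq_square)
  have Wl: "length xs < ?W" "Suc (length xs) < ?W" using W len by linarith+
  have adj_le: "g ''adj'' q \<le> 1" for q by (simp add: adj)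
  let ?f = "f(''u'' := 0, ''m'' := 0)"
  have rest: "runs ?W (Seq (Put ''vis'' (Var ''b'') (Num 1)) (Seq (Put ''pos'' (Var ''b'') (Var ''i''))
     (Seq (Assign ''u'' (Num 0)) (Seq update (Assign ''i'' (Plus (Var ''i'') (Num 1)))))))
     (?f(''u'' := n, ''m'' := m, ''b'' := v), g) (40 * n + 20)
     (\<lambda>s'. \<exists>v. sweep_inv n E z p (xs @ [v]) s')"
    if v: "v < n" "g ''vis'' v = 0" "\<And>u. u < n \<Longrightarrow> g ''vis'' u = 0 \<Longrightarrow> g ''key'' u \<le> g ''key'' v" for v m
  proof -
    have vxs: "v \<notin> set xs" using v(1,2) vis[OF v(1)] by (cases "v \<in> set xs") auto
    have vW: "v < ?W" using v(1) W by linarith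
    let ?f' = "f(''u'' := 0, ''m'' := m, ''b'' := v)"
    let ?g = "g(''vis'' := (g ''vis'')(v := 1), ''pos'' := (g ''pos'')(v := length xs))"
    have fin: "sweep_inv n E z p (xs @ [v])
        (?f'(''u'' := n, ''i'' := Suc (length xs)), ?g(''key'' := h))"
      if h: "\<And>u. u < n \<Longrightarrow> h u = ?g ''key'' u + ?g ''adj'' (v * n + u) * (n + 1)" for h
    proof -
      have "prio_seq n E p (xs @ [v])"
        by (rule prio_seq_snoc[OF xs v(1) vxs]) (use v vis key in auto)
      moreover have "h u = p u + card (neighbors E u \<inter> set (xs @ [v])) * (n + 1)" if u: "u < n" for u
      proof -
        have "neighbors E u \<inter> set (xs @ [v]) =
          (if {v, u} \<in> E then insert v (neighbors E u \<inter> set xs) else neighbors E u \<inter> set xs)"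
          by (auto simp: neighbors_def)
        then have "card (neighbors E u \<inter> set (xs @ [v])) =
          card (neighbors E u \<inter> set xs) + of_bool ({v, u} \<in> E)" using vxs by simp
        moreover have "g ''adj'' (v * n + u) = of_bool ({v, u} \<in> E)" using u by (simp add: adj)
        ultimately show ?thesis using h[OF u] key[OF u] by (simp add: algebra_simps)
      qed
      moreover have "(?g ''pos'') ((xs @ [v]) ! j) = j" if "j < length (xs @ [v])" for j
        using that pos[of j] vxs nth_mem[of j xs] by (auto simp: nth_append less_Suc_eq)
      ultimately show ?thesis
        unfolding sweep_inv_def using f vis adj by auto
    qed
    show ?thesis
      apply (rule runs_le)
       apply (rule runs_Seq, rule runs_Put)
         apply (use vW W in simp)
        apply (use W in simp)
       apply (rule runs_Seq, rule runs_Put)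
         apply (use vW W in simp)
        apply (use Wl f in simp)
       apply (rule runs_Seq, rule runs_Assign)
        apply (use W in simp)
       apply (rule runs_Seq)
       apply simp
       apply (rule runs_update[of _ n v])
            apply (use f W bound adj_le in \<open>simp_all\<close>)[5]
       apply (rule runs_Assign)
        apply (use f Wl in simp)
       apply (rule exI[of _ v])
      subgoal for h
        using fin[of h] f by (simp add: fun_upd_twist)
      apply simp
      done
  qed
  show ?thesis
    unfolding visit_next_def s
    apply (rule runs_le)
     apply (rule runs_Seq, rule runs_Assign)
      apply (use W in simp)
     apply (rule runs_Seq, rule runs_Assign)
      apply (use W in simp)
     apply (rule runs_Seq)
     apply (simp only: fst_conv snd_conv aval.simps)
     apply (rule runs_scan[of _ n _ _ u0])
            apply (use f W u0 vis in \<open>simp_all\<close>)[4]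
        apply (use bound[of _ 0] in simp)
       apply (use u0 vis in \<open>simp_all\<close>)[2]
     apply (rule rest; assumption)
    apply simp
    done
qed

lemma runs_sweep:
  assumes f: "f ''n'' = n" "f ''z'' = z"
    and adj: "g ''adj'' = (\<lambda>q. of_bool ({q div n, q mod n} \<in> E))"
    and vis: "\<And>u. u < n \<Longrightarrow> g ''vis'' u = 0"
    and p: "\<And>u. u < n \<Longrightarrow> g ''key'' u \<le> n"
    and Q: "\<And>xs s. length xs = n \<Longrightarrow> sweep_inv n E z (g ''key'') xs s \<Longrightarrow> Q s"
  shows "runs ((n + 2)\<^sup>2) sweep (f, g) (n * (80 * n + 44) + 6) Q"
proof -
  let ?W = "(n + 2)\<^sup>2"
  have loop: "runs ?W (While (Less (Var ''i'') (Var ''n'')) visit_next) (f(''i'' := 0), g)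
    (n * (80 * n + 44) + 4) Q"
  proof (rule runs_While[where I = "\<lambda>k s. \<exists>xs. length xs = k \<and> sweep_inv n E z (g ''key'') xs s" and N = n
      and B = "80 * n + 40"])
    show "\<exists>xs. length xs = 0 \<and> sweep_inv n E z (g ''key'') xs (f(''i'' := 0), g)"
      using f adj vis by (auto simp: sweep_inv_def prio_seq_def)
    show "\<not> bval (Less (Var ''i'') (Var ''n'')) s \<and> Q s"
      if fin: "\<exists>xs. length xs = n \<and> sweep_inv n E z (g ''key'') xs s" for s
    proof -
      obtain xs where xs: "length xs = n" "sweep_inv n E z (g ''key'') xs s" using fin by auto
      then have "fst s ''n'' = n" "fst s ''i'' = n" by (simp_all add: sweep_inv_def)
      then show ?thesis using Q[OF xs] by simp
    qed
    fix k s assume k: "k < n" and "\<exists>xs. length xs = k \<and> sweep_inv n E z (g ''key'') xs s"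
    then obtain xs where xs: "length xs = k" "sweep_inv n E z (g ''key'') xs s" by auto
    have "runs ?W visit_next s (80 * n + 40) (\<lambda>s'. \<exists>v. sweep_inv n E z (g ''key'') (xs @ [v]) s')"
      using runs_visit_next[OF xs(2)] xs(1) k p by simp
    then have "runs ?W visit_next s (80 * n + 40)
        (\<lambda>s'. \<exists>xs. length xs = Suc k \<and> sweep_inv n E z (g ''key'') xs s')"
      by (rule runs_mono, simp) (metis length_append_singleton xs(1))
    then show "bval (Less (Var ''i'') (Var ''n'')) s \<and> runs ?W visit_next s (80 * n + 40)
        (\<lambda>s'. \<exists>xs. length xs = Suc k \<and> sweep_inv n E z (g ''key'') xs s')"
      using k xs by (auto simp: sweep_inv_def)
  qed simp
  show ?thesis
    unfolding sweep_def
    apply (rule runs_le)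
     apply (rule runs_Seq, rule runs_Assign)
      apply simp
     apply (simp only: fst_conv snd_conv aval.simps, rule loop)
    apply simp
    done
qed

subsection \<open>Correctness of the two sweeps\<close>

lemma mcs_run_select:
  "mcs_run V E vs \<Longrightarrow> distinct vs \<and> set vs \<subseteq> V \<and> (\<forall>i<length vs. \<forall>u\<in>V - pre vs i.
     card (neighbors E u \<inter> pre vs i) \<le> card (neighbors E (vs ! i) \<inter> pre vs i))"
  by (induction rule: mcs_run.induct) (auto simp: nth_append less_Suc_eq)

lemma mcs_seq_run:
  assumes xs: "mcs_seq V E xs"
  shows "i < length xs \<Longrightarrow> mcs_run V E (take (Suc i) xs)"
proof (induction i)
  case 0
  then show ?case
    using xs nth_mem[of 0 xs] by (auto simp: mcs_seq_def take_Suc_conv_app_nth intro: mcs_run.start)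
next
  case (Suc i)
  then have "mcs_run V E (take (Suc i) xs @ [xs ! Suc i])"
    using xs nth_notin_pre[of xs "Suc i"] nth_mem[of "Suc i" xs]
    by (intro mcs_run.visit) (auto simp: mcs_seq_def)
  then show ?case using Suc.prems by (simp add: take_Suc_conv_app_nth)
qed

text \<open>Passage from orderings, which count from \<open>1\<close>, to lists.\<close>

lemma mcs_end_vertex_iff:
  assumes "finite V" "V \<noteq> {}"
  shows "mcs_end_vertex V E z \<longleftrightarrow> (\<exists>xs. mcs_seq V E xs \<and> last xs = z)"
proof
  assume "mcs_end_vertex V E z"
  then obtain \<sigma> where \<sigma>: "bij_betw \<sigma> V {1..card V}"
    "mcs_run V E (map (inv_into V \<sigma>) [1..<Suc (card V)])" "inv_into V \<sigma> (card V) = z"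
    by (auto simp: mcs_end_vertex_def mcs_ordering_def vertex_ordering_def end_vertex_def)
  let ?xs = "map (inv_into V \<sigma>) [1..<Suc (card V)]"
  have "bij_betw (inv_into V \<sigma>) {1..card V} V" using \<sigma>(1) by (rule bij_betw_inv_into)
  then have "set ?xs = V" by (auto simp: bij_betw_def atLeastLessThanSuc_atLeastAtMost simp del: upt_Suc)
  moreover have "card V \<noteq> 0" using assms by simp
  then have "last ?xs = z" using \<sigma>(3) by simp
  ultimately show "\<exists>xs. mcs_seq V E xs \<and> last xs = z"
    using mcs_run_select[OF \<sigma>(2)] by (auto simp: mcs_seq_def simp del: upt_Suc)
next
  assume "\<exists>xs. mcs_seq V E xs \<and> last xs = z"
  then obtain xs where xs: "mcs_seq V E xs" "last xs = z" by auto
  have d: "distinct xs" "set xs = V" using xs by (auto simp: mcs_seq_def)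
  have n: "length xs = card V" using d distinct_card by metis
  have n0: "card V \<noteq> 0" "xs \<noteq> []" using assms d by auto
  \<comment> \<open>\<open>i - 1\<close> converts positions to list indices; the ordering is the
    inverse of this map.\<close>
  let ?f = "\<lambda>i. xs ! (i - 1)"
  have f: "bij_betw ?f {1..card V} V"
  proof (rule bij_betw_imageI)
    show "inj_on ?f {1..card V}" using d(1) n by (auto simp: inj_on_def nth_eq_iff_index_eq)
    show "?f ` {1..card V} = V"
    proof
      show "?f ` {1..card V} \<subseteq> V" using d(2) n n0 by (auto intro!: nth_mem)
      show "V \<subseteq> ?f ` {1..card V}"
      proof
        fix x assume "x \<in> V"
        then obtain j where "j < card V" "x = xs ! j" using d(2) n by (auto simp: in_set_conv_nth)
        then show "x \<in> ?f ` {1..card V}" by (intro image_eqI[of _ _ "Suc j"]) auto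
      qed
    qed
  qed
  let ?\<sigma> = "inv_into {1..card V} ?f"
  have \<sigma>: "bij_betw ?\<sigma> V {1..card V}" using f by (rule bij_betw_inv_into)
  have inv: "inv_into V ?\<sigma> i = ?f i" if "i \<in> {1..card V}" for i
    using inv_into_inv_into_eq[OF f that] .
  have "map (inv_into V ?\<sigma>) [1..<Suc (card V)] = xs"
    using inv n by (intro nth_equalityI) (auto simp del: upt_Suc)
  moreover have "mcs_run V E xs"
    using mcs_seq_run[OF xs(1), of "length xs - 1"] n0 by simp
  moreover have "inv_into V ?\<sigma> (card V) = z"
    using inv[of "card V"] n0 n xs(2) by (simp add: last_conv_nth)
  ultimately show "mcs_end_vertex V E z"
    unfolding mcs_end_vertex_def mcs_ordering_def vertex_ordering_def end_vertex_def
    using \<sigma> by (intro exI[of _ ?\<sigma>]) simp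
qed

lemma prio_seq_lex:
  assumes xs: "prio_seq n E p xs" and p: "\<And>u. u < n \<Longrightarrow> p u \<le> n"
    and j: "j < length xs" and u: "u < n" "u \<notin> pre xs j"
  shows "card (neighbors E u \<inter> pre xs j) \<le> card (neighbors E (xs ! j) \<inter> pre xs j)"
    and "card (neighbors E (xs ! j) \<inter> pre xs j) \<le> card (neighbors E u \<inter> pre xs j) \<Longrightarrow> p u \<le> p (xs ! j)"
proof -
  let ?l = "\<lambda>u. card (neighbors E u \<inter> pre xs j)"
  have le: "p u + ?l u * (n + 1) \<le> p (xs ! j) + ?l (xs ! j) * (n + 1)"
    using xs j u by (auto simp: prio_seq_def)
  have "xs ! j < n" using xs nth_mem[OF j] by (auto simp: prio_seq_def)
  then have pn: "p (xs ! j) \<le> n" by (rule p)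
  show l: "?l u \<le> ?l (xs ! j)"
  proof (rule ccontr)
    assume "\<not> ?thesis"
    \<comment> \<open>One more neighbour counts \<open>n + 1\<close>, which outweighs the priority
      of \<open>xs ! j\<close>.\<close>
    then have "(?l (xs ! j) + 1) * (n + 1) \<le> ?l u * (n + 1)" by (intro mult_le_mono1) simp
    then show False using le pn by (simp add: algebra_simps)
  qed
  assume "?l (xs ! j) \<le> ?l u"
  then have "?l u = ?l (xs ! j)" using l by simp
  then show "p u \<le> p (xs ! j)" using le by simp
qed

lemma prio_seq_complete:
  assumes "prio_seq n E p xs" "length xs = n"
  shows "set xs = {..<n}"
  using assms by (intro card_seteq) (auto simp: prio_seq_def distinct_card)

lemma prio_seq_mcs:
  assumes "prio_seq n E p xs" "length xs = n" "\<And>u. u < n \<Longrightarrow> p u \<le> n"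
  shows "mcs_seq {..<n} E xs"
  unfolding mcs_seq_def
  using assms prio_seq_complete[OF assms(1,2)] prio_seq_lex(1)[OF assms(1,3)]
  by (auto simp: prio_seq_def)

text \<open>The priority of \<open>z\<close> makes the first sweep start there, and positions as
  priorities make the second sweep \<open>greedy\<close>. If the second sweep ends in
  \<open>z\<close>, it is a witness itself; the converse is \<open>greedy_last\<close>.\<close>

lemma two_sweep_end:
  assumes G: "simple_graph {..<n} E" "chordal {..<n} E" and z: "z < n"
    and T: "prio_seq n E (\<lambda>u. of_bool (u = z)) ts" "length ts = n"
    and R: "prio_seq n E p rs" "length rs = n"
    and p: "\<And>j. j < n \<Longrightarrow> p (ts ! j) = j"
  shows "last rs = z \<longleftrightarrow> mcs_end_vertex {..<n} E z"
proof -
  have ts_set: "set ts = {..<n}" using prio_seq_complete[OF T] .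
  have ts_mcs: "mcs_seq {..<n} E ts" using prio_seq_mcs[OF T] z by auto
  have pn: "p u \<le> n" if "u < n" for u
  proof -
    have "u \<in> set ts" using that ts_set by simp
    then obtain j where "j < n" "u = ts ! j" using T(2) by (auto simp: in_set_conv_nth)
    then show ?thesis using p by simp
  qed
  have rs_seq: "mcs_seq {..<n} E rs" using prio_seq_mcs[OF R pn] .
  interpret mcs_core "{..<n}" E ts by unfold_locales (fact G ts_mcs)+
  have l0: "0 < length ts" using z T(2) by simp
  have "(\<lambda>u. of_bool (u = z) :: nat) z \<le> (\<lambda>u. of_bool (u = z)) (ts ! 0)"
  proof (rule prio_seq_lex(2)[OF T(1) _ l0 z])
    show "of_bool (u = z) \<le> n" for u using z by (cases "u = z") auto
  qed simp_all
  then have t0: "ts ! 0 = z" by (simp add: of_bool_def split: if_splits)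
  have ties: "u \<in> pre ts k"
    if i: "i < length rs" and u: "u \<in> {..<n} - pre rs i"
      and le: "card (N (rs ! i) \<inter> pre rs i) \<le> card (N u \<inter> pre rs i)" and k: "rs ! i \<in> pre ts k"
    for i u k
  proof -
    have u': "u < n" "u \<notin> pre rs i" using u by auto
    have pu: "p u \<le> p (rs ! i)" by (rule prio_seq_lex(2)[OF R(1) pn i u' le])
    have "u \<in> set ts" using u ts_set by simp
    then obtain j where j: "j < n" "u = ts ! j" using T(2) by (auto simp: in_set_conv_nth)
    obtain l where l: "l < n" "l < k" "rs ! i = ts ! l"
      using k T(2) by (auto simp: in_set_conv_nth)
    then have "j < k" using pu p j by simp
    then show ?thesis using j T(2) by (auto simp: in_set_conv_nth)
  qed
  have greedy: "greedy rs" unfolding greedy_def using rs_seq ties by blast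
  have V: "{..<n} \<noteq> {}" "finite {..<n}" using z by auto
  show ?thesis
  proof
    assume "last rs = z"
    then show "mcs_end_vertex {..<n} E z" using mcs_end_vertex_iff[OF V(2,1)] rs_seq by blast
  next
    assume "mcs_end_vertex {..<n} E z"
    then obtain es where "mcs_seq {..<n} E es" "last es = z"
      using mcs_end_vertex_iff[OF V(2,1)] by blast
    then show "last rs = z" using greedy_last[OF _ _ V(1) greedy] t0 by auto
  qed
qed

lemma runs_two_sweeps:
  assumes G: "simple_graph {..<n} E" "chordal {..<n} E" and z: "z < n"
  shows "runs ((n + 2)\<^sup>2) two_sweeps (input_state n E z) (400 * n\<^sup>2)
    (\<lambda>s. answer s = (if mcs_end_vertex {..<n} E z then 1 else 0))"
proof -
  let ?W = "(n + 2)\<^sup>2"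
  let ?Q = "\<lambda>s. answer s = (if mcs_end_vertex {..<n} E z then 1 else 0)"
  have W: "n < ?W" "0 < ?W" "1 < ?W" "z < ?W" using z by (simp_all add: power2_eq_square)
  let ?f = "(\<lambda>_. 0)(''n'' := n, ''z'' := z)"
  let ?g = "(\<lambda>_ _. 0)(''adj'' := (\<lambda>q. of_bool ({q div n, q mod n} \<in> E)), ''key'' := (\<lambda>_. 0)(z := 1))"
  have key: "?g ''key'' = (\<lambda>u. of_bool (u = z))" by (auto simp: fun_eq_iff)
  \<comment> \<open>The right-hand side is \<open>160 * n * n + 128 * n + 36\<close>, and
    \<open>n \<ge> 1\<close> because of the vertex \<open>z\<close>.\<close>
  have time: "400 * n\<^sup>2 \<ge> 4 + ((n * (80 * n + 44) + 6) + ((40 * n + 10) + ((n * (80 * n + 44) + 6) + 10)))"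
  proof -
    have "n * 1 \<le> n * n" using z by (intro mult_le_mono2) simp
    moreover have "1 \<le> n" using z by simp
    moreover have "n * (80 * n + 44) = 80 * (n * n) + 44 * n" by (simp add: algebra_simps)
    ultimately show ?thesis unfolding power2_eq_square by linarith
  qed
  have last: "runs ?W (If (Equal (Var ''b'') (Var ''z'')) (Assign ''answer'' (Num 1)) (Assign ''answer'' (Num 0)))
      s 10 ?Q"
    if ts: "prio_seq n E (\<lambda>u. of_bool (u = z)) ts" "length ts = n"
      and p: "\<And>j. j < n \<Longrightarrow> p (ts ! j) = j"
      and rs: "length rs = n" "sweep_inv n E z p rs s" for ts p rs s
  proof -
    have "prio_seq n E p rs" and b: "fst s ''b'' = last rs" "fst s ''z'' = z"
      using rs z by (auto simp: sweep_inv_def)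
    then have iff: "last rs = z \<longleftrightarrow> mcs_end_vertex {..<n} E z"
      using two_sweep_end[OF G z ts _ rs(1) p] by simp
    show ?thesis
      apply (rule runs_le)
       apply (rule runs_rules | (use W b iff in \<open>simp add: answer_def; fail\<close>))+
      done
  qed
  have second: "runs ?W (Seq reset (Seq sweep
       (If (Equal (Var ''b'') (Var ''z'')) (Assign ''answer'' (Num 1)) (Assign ''answer'' (Num 0)))))
      s ((40 * n + 10) + ((n * (80 * n + 44) + 6) + 10)) ?Q"
    if ts: "length ts = n" "sweep_inv n E z (?g ''key'') ts s" for ts s
  proof -
    obtain f g where s: "s = (f, g)" by (cases s)
    have t: "prio_seq n E (\<lambda>u. of_bool (u = z)) ts" and f: "f ''n'' = n" "f ''z'' = z"
      and adj: "g ''adj'' = (\<lambda>q. of_bool ({q div n, q mod n} \<in> E))"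
      and pos: "\<And>j. j < n \<Longrightarrow> g ''pos'' (ts ! j) = j"
      using ts(2) unfolding key by (auto simp: sweep_inv_def s ts(1))
    have pn: "g ''pos'' u < n" if "u < n" for u
    proof -
      have "u \<in> set ts" using prio_seq_complete[OF t ts(1)] that by simp
      then show ?thesis using pos ts(1) by (auto simp: in_set_conv_nth)
    qed
    show ?thesis
      unfolding s
    proof (rule runs_Seq, rule runs_reset[where n = n])
      fix h h' :: "nat \<Rightarrow> nat"
      assume h: "\<And>u. u < n \<Longrightarrow> h u = g ''pos'' u" and h': "\<And>u. u < n \<Longrightarrow> h' u = 0"
      have ph: "h (ts ! j) = j" if "j < n" for j
        using h[of "ts ! j"] pos[OF that] prio_seq_complete[OF t ts(1)] nth_mem[of j ts] that ts(1) by simp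
      let ?g' = "g(''key'' := h, ''vis'' := h')"
      show "runs ?W (Seq sweep
         (If (Equal (Var ''b'') (Var ''z'')) (Assign ''answer'' (Num 1)) (Assign ''answer'' (Num 0))))
         (f(''u'' := n), ?g') ((n * (80 * n + 44) + 6) + 10) ?Q"
      proof (rule runs_Seq, rule runs_sweep[where z = z and E = E])
        show "runs ?W (If (Equal (Var ''b'') (Var ''z'')) (Assign ''answer'' (Num 1)) (Assign ''answer'' (Num 0)))
          s 10 ?Q" if "length rs = n" "sweep_inv n E z (?g' ''key'') rs s" for rs s
          using last[OF t ts(1) _ that(1), of h s] that(2) ph by simp
        show "?g' ''key'' u \<le> n" if "u < n" for u
          using h[OF that] pn[OF that] by simp
      qed (use f adj h' in simp_all)
    next
      show "g ''pos'' u < ?W" if "u < n" for u using pn[OF that] W(1) by linarith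
    qed (use f W in simp_all)
  qed
  have "runs ?W two_sweeps (input_state n E z)
    (4 + ((n * (80 * n + 44) + 6) + ((40 * n + 10) + ((n * (80 * n + 44) + 6) + 10)))) ?Q"
    unfolding two_sweeps_def
  proof (rule runs_Seq)
    have sweeps: "runs ?W (Seq sweep (Seq reset (Seq sweep
       (If (Equal (Var ''b'') (Var ''z'')) (Assign ''answer'' (Num 1)) (Assign ''answer'' (Num 0))))))
      (?f, ?g) ((n * (80 * n + 44) + 6) + ((40 * n + 10) + ((n * (80 * n + 44) + 6) + 10))) ?Q"
    proof (rule runs_Seq, rule runs_sweep[where z = z and E = E])
      show "?g ''key'' u \<le> n" if "u < n" for u using z that by simp
      show "runs ?W (Seq reset (Seq sweep
        (If (Equal (Var ''b'') (Var ''z'')) (Assign ''answer'' (Num 1)) (Assign ''answer'' (Num 0)))))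
        s ((40 * n + 10) + ((n * (80 * n + 44) + 6) + 10)) ?Q"
        if "length ts = n" "sweep_inv n E z (?g ''key'') ts s" for ts s
        using second[OF that] .
    qed simp_all
    have eq: "(fst (input_state n E z), (snd (input_state n E z))(''key'' := (snd (input_state n E z) ''key'')
        (aval (Var ''z'') (input_state n E z) := aval (Num 1) (input_state n E z)))) = (?f, ?g)"
      by (simp add: input_state_def)
    have W': "aval (Var ''z'') (input_state n E z) < ?W" "aval (Num 1) (input_state n E z) < ?W"
      using W by (simp_all add: input_state_def)
    show "runs ?W (Put ''key'' (Var ''z'') (Num 1)) (input_state n E z) 4 (\<lambda>s'. runs ?W (Seq sweep (Seq reset (Seq sweep
       (If (Equal (Var ''b'') (Var ''z'')) (Assign ''answer'' (Num 1)) (Assign ''answer'' (Num 0)))))) s'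
      ((n * (80 * n + 44) + 6) + ((40 * n + 10) + ((n * (80 * n + 44) + 6) + 10))) ?Q)"
      by (rule runs_le[OF runs_Put[OF W']]) (simp_all only: eq sweeps, simp)
  qed
  then show ?thesis using time by (rule runs_le)
qed

theorem theorem1:
  "\<exists>(c :: com) (k :: nat) (T :: nat \<Rightarrow> nat).
     (\<lambda>n. real (T n)) \<in> O(\<lambda>n. real n ^ 2) \<and>
     (\<forall>(n :: nat) (E :: nat set set) (z :: nat).
        simple_graph {..<n} E \<longrightarrow> chordal {..<n} E \<longrightarrow> z \<in> {..<n} \<longrightarrow>
        (\<exists>t s. exec ((n + 2) ^ k) c (input_state n E z) t s \<and> t \<le> T n \<and>
           answer s = (if mcs_end_vertex {..<n} E z then 1 else 0)))"
proof (rule exI[of _ two_sweeps], rule exI[of _ 2], rule exI[of _ "\<lambda>n. 400 * n\<^sup>2"], intro conjI allI impI)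
  show "(\<lambda>n. real (400 * n\<^sup>2)) \<in> O(\<lambda>n. real n ^ 2)" by simp
  show "\<exists>t s. exec ((n + 2) ^ 2) two_sweeps (input_state n E z) t s \<and> t \<le> 400 * n\<^sup>2 \<and>
      answer s = (if mcs_end_vertex {..<n} E z then 1 else 0)"
    if "simple_graph {..<n} E" "chordal {..<n} E" "z \<in> {..<n}" for n E z
    using runs_two_sweeps[of n E z] that unfolding runs_def by simp
qed

end
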